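(* Let $f:\mathbb{R}^n\times\mathbb{R}^m\to\mathbb{R}^n$ and $h:\mathbb{R}^n\to\mathbb{R}^p$ be locally Lipschitz with $f(0,0)=0$, $h(0)=0$, and consider the system $\dot x=f(x,u)$, $y=h(x)$. The following are equivalent: (1) The system is IOS. (2) The system is OLIOS under output redefinition, i.e. there exist a locally Lipschitz map $h_0:\mathbb{R}^n\to\mathbb{R}_{\ge 0}$ with $h_0(0)=0$ and a function $\chi\in\mathcal{K}_\infty$ such that $h_0(\xi)\ge \chi(|h(\xi)|)$ for all $\xi\in\mathbb{R}^n$ and the system $\dot x=f(x,u)$, $y=h_0(x)$ is OLIOS.
   Context: Inputs are measurable, locally essentially bounded functions $u:[0,\infty)\to\mathbb{R}^m$; $\|u\|$ denotes the (possibly infinite) essential supremum of $|u(t)|$, with $|\cdot|$ the Euclidean norm. For an initial state $\xi$ and input $u$, $x(\cdot,\xi,u)$ is the unique maximal solution of $\dot x=f(x,u)$, $x(0)=\xi$, and $y(t,\xi,u)=h(x(t,\xi,u))$ (for a redefined output map, $y$ is computed with that map). The system is forward complete if every such solution is defined for all $t\ge 0$. A function $\gamma:[0,\infty)\to[0,\infty)$ is of class $\mathcal{K}$ if it is continuous, strictly increasing and $\gamma(0)=0$; of class $\mathcal{K}_\infty$ if moreover unbounded; $\beta:[0,\infty)^2\to[0,\infty)$ is of class $\mathcal{KL}$ if $\beta(\cdot,t)\in\mathcal{K}$ for each $t$ and $\beta(s,\cdot)$ decreases to $0$ for each $s$. A forward complete system is IOS (input to output stable) if there exist $\beta\in\mathcal{KL}$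 and $\gamma\in\mathcal{K}$ such that $|y(t,\xi,u)|\le \beta(|\xi|,t)+\gamma(\|u\|)$ for all $t\ge0$, all inputs $u$ and all $\xi\in\mathbb{R}^n$. It is OLIOS (output-Lagrange input to output stable) if it is IOS and there exist $\sigma_1,\sigma_2\in\mathcal{K}$ such that $|y(t,\xi,u)|\le\max\{\sigma_1(|h(\xi)|),\sigma_2(\|u\|)\}$ for all $t\ge0$, all $u$ and all $\xi$ (with $h$ the output map of that system). *)

theory Defs
  imports "HOL-Analysis.Analysis"
begin

definition loc_lipschitz :: "('a::metric_space \<Rightarrow> 'b::metric_space) \<Rightarrow> bool" where
  "loc_lipschitz F \<longleftrightarrow> (\<forall>z. \<exists>e>0. \<exists>L. L-lipschitz_on (ball z e) F)"

definition classK :: "(real \<Rightarrow> real) \<Rightarrow> bool" where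
  "classK g \<longleftrightarrow> continuous_on {0..} g \<and> strict_mono_on {0..} g \<and> g 0 = 0"

definition classKinf :: "(real \<Rightarrow> real) \<Rightarrow> bool" where
  "classKinf g \<longleftrightarrow> classK g \<and> (\<forall>r. \<exists>s\<ge>0. g s > r)"

definition classKL :: "(real \<Rightarrow> real \<Rightarrow> real) \<Rightarrow> bool" where
  "classKL b \<longleftrightarrow> (\<forall>t\<ge>0. classK (\<lambda>s. b s t)) \<and>
     (\<forall>s\<ge>0. (\<forall>t1 t2. 0 \<le> t1 \<and> t1 \<le> t2 \<longrightarrow> b s t2 \<le> b s t1) \<and> ((\<lambda>t. b s t) \<longlongrightarrow> 0) at_top)"

definition admissible_input :: "(real \<Rightarrow> 'm::euclidean_space) \<Rightarrow> bool" where
  "admissible_input u \<longleftrightarrow> u \<in> borel_measurable (restrict_space lebesgue {0..}) \<and>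
     (\<forall>T\<ge>0. \<exists>M. AE t in lebesgue. t \<in> {0..T} \<longrightarrow> norm (u t) \<le> M)"

text \<open>M is an essential bound of u on [0,\<infinity>); the essential supremum is the least such M.\<close>
definition ess_bound :: "(real \<Rightarrow> 'm::euclidean_space) \<Rightarrow> real \<Rightarrow> bool" where
  "ess_bound u M \<longleftrightarrow> (AE t in lebesgue. t \<in> {0..} \<longrightarrow> norm (u t) \<le> M)"

text \<open>Carath\'eodory solution of x' = f(x,u), x(0) = xi on [0,T].\<close>
definition is_solution_on ::
  "('n::euclidean_space \<times> 'm::euclidean_space \<Rightarrow> 'n) \<Rightarrow> (real \<Rightarrow> 'm) \<Rightarrow> 'n \<Rightarrow> (real \<Rightarrow> 'n) \<Rightarrow> real \<Rightarrow> bool" where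
  "is_solution_on f u xi x T \<longleftrightarrow>
     (\<forall>t\<in>{0..T}. ((\<lambda>s. f (x s, u s)) has_integral (x t - xi)) {0..t})"

definition is_global_solution ::
  "('n::euclidean_space \<times> 'm::euclidean_space \<Rightarrow> 'n) \<Rightarrow> (real \<Rightarrow> 'm) \<Rightarrow> 'n \<Rightarrow> (real \<Rightarrow> 'n) \<Rightarrow> bool" where
  "is_global_solution f u xi x \<longleftrightarrow> (\<forall>T\<ge>0. is_solution_on f u xi x T)"

definition forward_complete ::
  "('n::euclidean_space \<times> 'm::euclidean_space \<Rightarrow> 'n) \<Rightarrow> bool" where
  "forward_complete f \<longleftrightarrow>
     (\<forall>xi (u::real \<Rightarrow> 'm). admissible_input u \<longrightarrow> (\<exists>x. is_global_solution f u xi x))"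

definition IOS ::
  "('n::euclidean_space \<times> 'm::euclidean_space \<Rightarrow> 'n) \<Rightarrow> ('n \<Rightarrow> 'y::real_normed_vector) \<Rightarrow> bool" where
  "IOS f h \<longleftrightarrow> forward_complete f \<and>
     (\<exists>\<beta> \<gamma>. classKL \<beta> \<and> classK \<gamma> \<and>
       (\<forall>xi (u::real \<Rightarrow> 'm) x t M. admissible_input u \<and> is_global_solution f u xi x \<and> t \<ge> 0
          \<and> ess_bound u M \<longrightarrow> norm (h (x t)) \<le> \<beta> (norm xi) t + \<gamma> M))"

definition OLIOS ::
  "('n::euclidean_space \<times> 'm::euclidean_space \<Rightarrow> 'n) \<Rightarrow> ('n \<Rightarrow> 'y::real_normed_vector) \<Rightarrow> bool" where
  "OLIOS f h \<longleftrightarrow> IOS f h \<and>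
     (\<exists>\<sigma>1 \<sigma>2. classK \<sigma>1 \<and> classK \<sigma>2 \<and>
       (\<forall>xi (u::real \<Rightarrow> 'm) x t M. admissible_input u \<and> is_global_solution f u xi x \<and> t \<ge> 0
          \<and> ess_bound u M \<longrightarrow> norm (h (x t)) \<le> max (\<sigma>1 (norm (h xi))) (\<sigma>2 M)))"

end

theory Submission
  imports Defs
begin

text \<open>Let \<open>V \<xi>\<close> be the supremum of \<open>\<bar>y(t,\<xi>,u)\<bar> - (\<gamma> M +
  M)\<close> over all times \<open>t\<close> and all inputs \<open>u\<close> bounded by \<open>M\<close>.
  Concatenating inputs gives \<open>V(x(t)) \<le> V \<xi> + \<gamma> M + M\<close> and \<open>V(x(t))
  \<le> \<beta>(\<bar>\<xi>\<bar>,t) + \<gamma> M + M\<close>, so \<open>V\<close> is the desired output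
  except that it need not be locally Lipschitz where it vanishes. Above each positive level it is
  Lipschitz on balls, because there only bounded times and inputs matter and the corresponding reachable
  set is bounded; a flat enough rescaling \<open>\<rho> \<circ> V\<close> removes the singularity.

  The substance is that bounded inputs and initial states of a forward complete system have bounded
  reachable sets in bounded time. If trajectories starting near a state \<open>\<eta>\<close> with time
  \<open>T\<close> left are unbounded, then after a short step the same holds, with less time left, for a
  limit point of reachable states. This produces an approximate orbit that leaves every ball in finite
  time. The flow over a short step is a contractive perturbation of the identity, so it can be inverted
  locally, and the approximate orbit is shadowed by a true trajectory, which would then have to blow
  up.\<close>

section \<open>Solutions and their dependence on the initial state\<close>

text \<open>Compactness turns the local constants into a single one, even on a set that is not
  convex. The library result concerns time-dependent families, so a constant family over the
  one-point time set \<open>{0}\<close> is used.\<close>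

lemma loc_lipschitz_compact:
  fixes F :: "'a::metric_space \<Rightarrow> 'b::metric_space"
  assumes "loc_lipschitz F" "compact S"
  obtains L where "L-lipschitz_on S F"
proof -
  have "local_lipschitz {0::real} UNIV (\<lambda>_. F)"
    unfolding local_lipschitz_def
  proof safe
    fix z
    from assms(1) obtain e L where "e > 0" "L-lipschitz_on (ball z e) F"
      unfolding loc_lipschitz_def by blast
    then show "\<exists>r>0. \<exists>L. \<forall>t\<in>cball 0 r \<inter> {0::real}. L-lipschitz_on (cball z r \<inter> UNIV) F"
      by (intro exI[of _ "e/2"] conjI exI[of _ L])
        (auto intro: lipschitz_on_subset)
  qed
  then have "local_lipschitz {0::real} S (\<lambda>_. F)"
    by (rule local_lipschitz_subset) auto
  then show thesis
    using local_lipschitz_compact_implies_lipschitz[of "{0::real}" S "\<lambda>_. F"] assms(2) that by auto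
qed

lemma loc_lipschitz_continuous_on:
  assumes "loc_lipschitz F"
  shows "continuous_on S F"
proof (rule continuous_at_imp_continuous_on, safe)
  fix z
  from assms obtain e L where "e > 0" "L-lipschitz_on (ball z e) F"
    unfolding loc_lipschitz_def by blast
  then show "isCont F z"
    using lipschitz_on_continuous_on continuous_on_interior by (metis centre_in_ball interior_ball)
qed

lemma gronwall:
  fixes g :: "real \<Rightarrow> real"
  assumes cont: "continuous_on {0..T} g" and L: "0 \<le> L"
    and le: "\<And>t. t \<in> {0..T} \<Longrightarrow> g t \<le> a + L * integral {0..t} g"
    and t: "t \<in> {0..T}"
  shows "g t \<le> a * exp (L * t)"
proof -
  \<comment> \<open>The integrating factor makes \<open>G\<close> nonincreasing: hypothesis
    \<open>le\<close> says exactly that its derivative is nonpositive.\<close>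
  define G where "G = (\<lambda>t. (a + L * integral {0..t} g) * exp (- L * t))"
  have der: "(G has_real_derivative (L * (g s - (a + L * integral {0..s} g))) * exp (- L * s))
      (at s within {0..T})" if "s \<in> {0..T}" for s
    unfolding G_def
    using that
    by (auto intro!: derivative_eq_intros integral_has_real_derivative[OF cont] simp: algebra_simps)
  have "G t \<le> G 0"
  proof (rule DERIV_nonpos_imp_decreasing_open[of 0 t G])
    show "0 \<le> t" using t by simp
    show "continuous_on {0..t} G"
      by (rule continuous_on_subset[OF DERIV_continuous_on[OF der]]) (use t in auto)
  next
    fix s assume s: "0 < s" "s < t"
    then have "at s within {0..T} = at s"
      using t by (intro at_within_interior) auto
    then show "\<exists>y. (G has_real_derivative y) (at s) \<and> y \<le> 0"
      using der[of s] le[of s] s t L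
      by (intro exI conjI) (auto simp: mult_nonpos_nonneg mult_nonneg_nonpos)
  qed
  then have "a + L * integral {0..t} g \<le> a * exp (L * t)"
    by (simp add: G_def exp_minus field_simps)
  then show ?thesis using le[OF t] by linarith
qed

lemma is_solution_onD:
  assumes "is_solution_on f u xi x T" "t \<in> {0..T}"
  shows "((\<lambda>s. f (x s, u s)) has_integral (x t - xi)) {0..t}"
  using assms by (auto simp: is_solution_on_def)

lemma is_solution_on_mono:
  assumes "is_solution_on f u xi x T" "S \<le> T"
  shows "is_solution_on f u xi x S"
  using assms by (auto simp: is_solution_on_def)

lemma is_solution_on_initial:
  assumes "is_solution_on f u xi x T" "0 \<le> T"
  shows "x 0 = xi"
  using is_solution_onD[OF assms(1), of 0] assms(2) has_integral_refl(2)[of _ "0::real"]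
  by (auto dest: has_integral_unique)

lemma is_solution_on_continuous:
  fixes f :: "'n::euclidean_space \<times> 'm::euclidean_space \<Rightarrow> 'n"
  assumes "is_solution_on f u xi x T"
  shows "continuous_on {0..T} x"
proof (cases "0 \<le> T")
  case True
  have "(\<lambda>s. f (x s, u s)) integrable_on {0..T}"
    using is_solution_onD[OF assms, of T] True by auto
  then have "continuous_on {0..T} (\<lambda>t. xi + integral {0..t} (\<lambda>s. f (x s, u s)))"
    by (intro continuous_intros indefinite_integral_continuous_1)
  moreover have "xi + integral {0..t} (\<lambda>s. f (x s, u s)) = x t" if "t \<in> {0..T}" for t
    using integral_unique[OF is_solution_onD[OF assms that]] by simp
  ultimately show ?thesis using continuous_on_cong by (metis (mono_tags, lifting))
qed simp

text \<open>The integral equation does not see null sets. This serves both for endpoint values of an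
  input and for the passage from essential to pointwise bounds.\<close>

lemma is_solution_on_spike:
  assumes "is_solution_on f u xi x T" "negligible N" "\<And>t. t \<in> {0..T} - N \<Longrightarrow> v t = u t"
  shows "is_solution_on f v xi x T"
  unfolding is_solution_on_def
proof
  fix t assume t: "t \<in> {0..T}"
  show "((\<lambda>s. f (x s, v s)) has_integral x t - xi) {0..t}"
    by (rule has_integral_spike[OF assms(2) _ is_solution_onD[OF assms(1) t]])
      (use assms(3) t in auto)
qed

text \<open>Comparing increments instead of states serves two purposes: it yields the Gronwall
  estimate, and it shows that the short-time flow minus the identity is contractive.\<close>

lemma solution_increment_diff:
  fixes f :: "'n::euclidean_space \<times> 'm::euclidean_space \<Rightarrow> 'n"
  assumes x: "is_solution_on f u xi x T" and y: "is_solution_on f v eta y T"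
    and le: "\<And>s. s \<in> {0..T} \<Longrightarrow> norm (f (x s, u s) - f (y s, v s)) \<le> L * norm (x s - y s)"
    and t: "t \<in> {0..T}"
  shows "norm ((x t - xi) - (y t - eta)) \<le> L * integral {0..t} (\<lambda>s. norm (x s - y s))"
proof -
  have int: "((\<lambda>s. f (x s, u s) - f (y s, v s)) has_integral (x t - xi) - (y t - eta)) {0..t}"
    using is_solution_onD[OF x t] is_solution_onD[OF y t] by (rule has_integral_diff)
  have "continuous_on {0..t} (\<lambda>s. norm (x s - y s))"
    using t
    by (intro continuous_intros continuous_on_subset[OF is_solution_on_continuous[OF x]]
        continuous_on_subset[OF is_solution_on_continuous[OF y]]) auto
  then have c: "(\<lambda>s. L * norm (x s - y s)) integrable_on {0..t}"
    by (intro integrable_continuous_real continuous_on_mult_left)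
  have "norm (integral {0..t} (\<lambda>s. f (x s, u s) - f (y s, v s)))
      \<le> integral {0..t} (\<lambda>s. L * norm (x s - y s))"
    by (rule integral_norm_bound_integral) (use int c le t in auto)
  then show ?thesis using integral_unique[OF int] by simp
qed

lemma solution_dependence:
  fixes f :: "'n::euclidean_space \<times> 'm::euclidean_space \<Rightarrow> 'n"
  assumes x: "is_solution_on f u xi x T" and y: "is_solution_on f v eta y T" and "0 \<le> L"
    and le: "\<And>s. s \<in> {0..T} \<Longrightarrow> norm (f (x s, u s) - f (y s, v s)) \<le> L * norm (x s - y s)"
    and t: "t \<in> {0..T}"
  shows "norm (x t - y t) \<le> norm (xi - eta) * exp (L * t)"
proof (rule gronwall[where g = "\<lambda>s. norm (x s - y s)" and T = T])
  show "continuous_on {0..T} (\<lambda>s. norm (x s - y s))"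
    by (intro continuous_intros is_solution_on_continuous[OF x] is_solution_on_continuous[OF y])
next
  fix s assume "s \<in> {0..T}"
  from solution_increment_diff[OF x y le this]
  show "norm (x s - y s) \<le> norm (xi - eta) + L * integral {0..s} (\<lambda>s. norm (x s - y s))"
    using norm_triangle_ineq[of "(x s - xi) - (y s - eta)" "xi - eta"] by (simp add: algebra_simps)
qed fact+

lemma lipschitz_on_fst_arg:
  fixes f :: "'n::real_normed_vector \<times> 'm::real_normed_vector \<Rightarrow> 'k::real_normed_vector"
  assumes "L-lipschitz_on (K \<times> U) f" "a \<in> K" "b \<in> K" "w \<in> U"
  shows "norm (f (a, w) - f (b, w)) \<le> L * norm (a - b)"
  using lipschitz_onD[OF assms(1), of "(a, w)" "(b, w)"] assms(2-)
  by (simp add: dist_Pair_Pair dist_norm)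

text \<open>A bounded input and continuous solutions confine the arguments of \<open>f\<close> to a
  compact set, where one Lipschitz constant and Gronwall's inequality apply. Agreement on the
  half-open interval is enough because the endpoint is a null set; concatenated inputs agree in just
  this sense.\<close>

lemma solution_unique:
  fixes f :: "'n::euclidean_space \<times> 'm::euclidean_space \<Rightarrow> 'n"
  assumes f: "loc_lipschitz f"
    and x: "is_solution_on f u xi x T" and y: "is_solution_on f v xi y T"
    and uv: "\<And>s. 0 \<le> s \<Longrightarrow> s < T \<Longrightarrow> u s = v s" and bd: "\<And>s. norm (u s) \<le> R"
    and t: "t \<in> {0..T}"
  shows "x t = y t"
proof -
  have y': "is_solution_on f u xi y T"
    by (rule is_solution_on_spike[OF y, of "{T}"]) (use uv in auto)
  define K where "K = x ` {0..T} \<union> y ` {0..T}"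
  have "compact (K \<times> cball 0 R :: ('n \<times> 'm) set)"
    unfolding K_def
    by (intro compact_Times compact_Un compact_continuous_image is_solution_on_continuous[OF x]
        is_solution_on_continuous[OF y] compact_cball) auto
  then obtain L where L: "L-lipschitz_on (K \<times> cball 0 R) f"
    using loc_lipschitz_compact f by blast
  have "norm (x t - y t) \<le> norm (xi - xi) * exp (L * t)"
    using lipschitz_on_nonneg[OF L] bd
    by (intro solution_dependence[OF x y' _ _ t] lipschitz_on_fst_arg[OF L]) (auto simp: K_def)
  then show ?thesis by simp
qed

section \<open>Bounded inputs, their shifts and concatenations\<close>

text \<open>The bound holds at every time, not just almost every time, so that the arguments of
  \<open>f\<close> stay in a compact set throughout. Measurability on the whole line makes the class
  invariant under shifts.\<close>

definition inputs :: "real \<Rightarrow> (real \<Rightarrow> 'm::euclidean_space) set" where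
  "inputs R = {u. u \<in> borel_measurable lebesgue \<and> (\<forall>t. norm (u t) \<le> R)}"

lemma inputsD:
  assumes "u \<in> inputs R"
  shows "u \<in> borel_measurable lebesgue" "norm (u t) \<le> R"
  using assms by (auto simp: inputs_def)

lemma inputs_nonneg: "u \<in> inputs R \<Longrightarrow> 0 \<le> R"
  using inputsD(2)[of u R 0] norm_ge_zero[of "u 0"] by linarith

lemma inputs_mono: "u \<in> inputs R \<Longrightarrow> R \<le> R' \<Longrightarrow> u \<in> inputs R'"
  unfolding inputs_def by (auto intro: order_trans)

lemma zero_input: "0 \<le> R \<Longrightarrow> (\<lambda>_. 0) \<in> inputs R"
  by (simp add: inputs_def)

lemma inputs_admissible: "u \<in> inputs R \<Longrightarrow> admissible_input u"
  by (auto simp: inputs_def admissible_input_def intro!: measurable_restrict_space1 exI[of _ R])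

lemma inputs_ess_bound: "u \<in> inputs R \<Longrightarrow> ess_bound u R"
  by (auto simp: inputs_def ess_bound_def)

lemma measurable_shift:
  assumes "u \<in> borel_measurable lebesgue"
  shows "(\<lambda>t::real. u (t + s)) \<in> borel_measurable lebesgue"
proof -
  have "(\<lambda>t::real. s + (\<Sum>j\<in>Basis. (1 * (t \<bullet> j)) *\<^sub>R j)) \<in> lebesgue \<rightarrow>\<^sub>M lebesgue"
    by (rule lebesgue_affine_measurable) simp
  then have "(\<lambda>t::real. t + s) \<in> lebesgue \<rightarrow>\<^sub>M lebesgue" by (simp add: add.commute)
  from measurable_compose[OF this assms] show ?thesis .
qed

lemma inputs_shift: "u \<in> inputs R \<Longrightarrow> (\<lambda>t. u (t + s)) \<in> inputs R"
  using measurable_shift by (auto simp: inputs_def)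

definition splice :: "real \<Rightarrow> (real \<Rightarrow> 'm) \<Rightarrow> (real \<Rightarrow> 'm) \<Rightarrow> real \<Rightarrow> 'm" where
  "splice s u v = (\<lambda>t. if t < s then u t else v (t - s))"

lemma inputs_splice:
  assumes "u \<in> inputs R" "v \<in> inputs R"
  shows "splice s u v \<in> inputs R"
proof -
  have "splice s u v \<in> borel_measurable lebesgue"
    unfolding splice_def
    using inputsD(1)[OF assms(1)] measurable_shift[OF inputsD(1)[OF assms(2)], of "- s"]
    by (intro measurable_If) auto
  then show ?thesis using assms by (auto simp: inputs_def splice_def)
qed

section \<open>The flow and its cocycle property\<close>

locale complete_system =
  fixes f :: "'n::euclidean_space \<times> 'm::euclidean_space \<Rightarrow> 'n"
  assumes lip: "loc_lipschitz f" and complete: "forward_complete f"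
begin

text \<open>For an input in some \<open>inputs R\<close>, uniqueness determines the chosen solution
  at nonnegative times; its values at negative times are arbitrary.\<close>

definition flow :: "(real \<Rightarrow> 'm) \<Rightarrow> 'n \<Rightarrow> real \<Rightarrow> 'n" where
  "flow u xi = (SOME x. is_global_solution f u xi x)"

lemma flow_solution: "u \<in> inputs R \<Longrightarrow> is_global_solution f u xi (flow u xi)"
proof -
  assume "u \<in> inputs R"
  then have "\<exists>x. is_global_solution f u xi x"
    using complete inputs_admissible[of u R] by (simp add: forward_complete_def)
  then show ?thesis unfolding flow_def by (rule someI_ex)
qed

lemma flow_solution_on: "u \<in> inputs R \<Longrightarrow> is_solution_on f u xi (flow u xi) T"
  by (rule is_solution_on_mono[where T = "max T 0"])
    (use flow_solution[of u R xi] in \<open>auto simp: is_global_solution_def\<close>)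

lemma flow_0 [simp]: "u \<in> inputs R \<Longrightarrow> flow u xi 0 = xi"
  using is_solution_on_initial[OF flow_solution_on[where T = 0]] by blast

lemma flow_continuous: "u \<in> inputs R \<Longrightarrow> continuous_on {0..T} (flow u xi)"
  by (rule is_solution_on_continuous[OF flow_solution_on])

lemma flow_eqI:
  assumes "u \<in> inputs R" "is_solution_on f v xi x T" "t \<in> {0..T}"
    and "\<And>s. 0 \<le> s \<Longrightarrow> s < T \<Longrightarrow> u s = v s"
  shows "flow u xi t = x t"
  by (rule solution_unique[OF lip flow_solution_on[OF assms(1)] assms(2) assms(4) _ assms(3)])
    (use inputsD(2)[OF assms(1)] in auto)

lemma flow_cong:
  assumes "u \<in> inputs R" "v \<in> inputs R'" "t \<in> {0..T}"
    and "\<And>s. 0 \<le> s \<Longrightarrow> s < T \<Longrightarrow> u s = v s"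
  shows "flow u xi t = flow v xi t"
  using flow_eqI[OF assms(1) flow_solution_on[OF assms(2)] assms(3,4)] .

text \<open>By additivity of the integral, the shifted trajectory solves the equation with the
  shifted input, and uniqueness identifies it with the flow.\<close>

lemma flow_shift:
  assumes u: "u \<in> inputs R" and s: "0 \<le> s" and t: "0 \<le> t"
  shows "flow u xi (t + s) = flow (\<lambda>r. u (r + s)) (flow u xi s) t"
proof (rule sym, rule flow_eqI[OF inputs_shift[OF u]])
  let ?x = "flow u xi" and ?g = "\<lambda>r. f (flow u xi r, u r)"
  show "is_solution_on f (\<lambda>r. u (r + s)) (?x s) (\<lambda>t. ?x (t + s)) t"
    unfolding is_solution_on_def
  proof
    fix r assume r: "r \<in> {0..t}"
    have a: "(?g has_integral (?x s - xi)) {0..s}"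
      using is_solution_onD[OF flow_solution_on[OF u], of s s] s by simp
    have b: "(?g has_integral (?x (r + s) - xi)) {0..r + s}"
      using is_solution_onD[OF flow_solution_on[OF u], of "r + s" "r + s"] s r by simp
    have "?g integrable_on {s..r + s}"
      using b s r by (auto intro: integrable_subinterval_real)
    then obtain j where j: "(?g has_integral j) {s..r + s}" by blast
    have "(?g has_integral (?x s - xi + j)) {0..r + s}"
      by (rule has_integral_combine[OF _ _ a j]) (use s r in auto)
    from has_integral_unique[OF this b] have "j = ?x (r + s) - ?x s" 
      by (simp add: algebra_simps)
    with has_integral_shift_real_ivl[OF j, of s]
    show "((\<lambda>q. f (?x (q + s), u (q + s))) has_integral (?x (r + s) - ?x s)) {0..r}" by simp
  qed
qed (use t in auto)

lemma flow_splice: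
  assumes u: "u \<in> inputs R" and v: "v \<in> inputs R'" and s: "0 \<le> s" and t: "0 \<le> t"
  shows "flow (splice s u v) xi (t + s) = flow v (flow u xi s) t"
proof -
  let ?w = "splice s u v"
  have w: "?w \<in> inputs (max R R')"
    by (intro inputs_splice inputs_mono[OF u] inputs_mono[OF v]) auto
  have "flow ?w xi s = flow u xi s"
    by (rule flow_cong[OF w u, where T = s]) (use s in \<open>auto simp: splice_def\<close>)
  moreover have "flow (\<lambda>r. ?w (r + s)) (flow u xi s) t = flow v (flow u xi s) t"
    by (rule flow_cong[OF inputs_shift[OF w] v, where T = t]) (use t in \<open>auto simp: splice_def\<close>)
  ultimately show ?thesis using flow_shift[OF w s t, of xi] by simp
qed

end

section \<open>Boundedness of reachable sets\<close>

text \<open>Solving \<open>\<Phi> z = w\<close> amounts to finding a fixed point of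
  \<open>w - (\<Phi> z - z)\<close>. This map contracts by 1/2, and the bound on
  \<open>w - \<Phi> c\<close> makes it map the ball into itself, so Banach's theorem
  applies.\<close>

lemma near_identity_onto_cball:
  fixes \<Phi> :: "'a::euclidean_space \<Rightarrow> 'a"
  assumes contr: "\<And>x y. x \<in> cball c r \<Longrightarrow> y \<in> cball c r \<Longrightarrow>
      norm ((\<Phi> x - x) - (\<Phi> y - y)) \<le> norm (x - y) / 2"
    and w: "norm (w - \<Phi> c) \<le> r / 2"
  obtains z where "z \<in> cball c r" "\<Phi> z = w"
proof -
  have r: "0 \<le> r" using w norm_ge_zero[of "w - \<Phi> c"] by linarith
  have "\<exists>!z. z \<in> cball c r \<and> w - (\<Phi> z - z) = z"
  proof (rule Banach_fix[where c = "1/2"])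
    show "(\<lambda>z. w - (\<Phi> z - z)) ` cball c r \<subseteq> cball c r"
    proof safe
      fix z assume z: "z \<in> cball c r"
      have "norm ((w - (\<Phi> z - z)) - c) = norm ((w - \<Phi> c) - ((\<Phi> z - z) - (\<Phi> c - c)))"
        by (simp add: algebra_simps)
      also have "\<dots> \<le> norm (w - \<Phi> c) + norm ((\<Phi> z - z) - (\<Phi> c - c))"
        by (rule norm_triangle_ineq4)
      also have "\<dots> \<le> r / 2 + norm (z - c) / 2"
        using w contr[OF z, of c] r by (intro add_mono) auto
      also have "\<dots> \<le> r"
        using z by (simp add: dist_norm norm_minus_commute)
      finally show "w - (\<Phi> z - z) \<in> cball c r"
        by (simp add: dist_norm norm_minus_commute)
    qed
  next
    fix x y assume "x \<in> cball c r" "y \<in> cball c r"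
    from contr[OF this] show "dist (w - (\<Phi> x - x)) (w - (\<Phi> y - y)) \<le> 1/2 * dist x y"
      by (simp add: dist_norm norm_minus_commute algebra_simps)
  qed (use r in \<open>auto simp: compact_imp_complete\<close>)
  then show thesis using that by (auto simp: algebra_simps)
qed

context complete_system
begin

text \<open>First-exit argument: until the norm first reaches \<open>\<rho> + 1\<close> the speed is
  at most \<open>B\<close>, so the displacement within time \<open>D\<close> stays below 1.\<close>

lemma short_time_bound:
  assumes B: "\<And>z w. norm z \<le> \<rho> + 1 \<Longrightarrow> norm w \<le> R \<Longrightarrow> norm (f (z, w)) \<le> B"
    and BD: "B * D < 1" and xi: "norm xi \<le> \<rho>" and u: "u \<in> inputs R" and t: "t \<in> {0..D}"
  shows "norm (flow u xi t) \<le> \<rho> + 1"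
proof (rule ccontr)
  let ?x = "flow u xi"
  assume neg: "\<not> norm (?x t) \<le> \<rho> + 1"
  define S where "S = {s \<in> {0..D}. norm (?x s) \<in> {\<rho> + 1..}}"
  have cont: "continuous_on {0..D} (\<lambda>s. norm (?x s))"
    by (intro continuous_intros flow_continuous[OF u])
  have "closed S"
    using continuous_closed_preimage[OF cont closed_real_atLeastAtMost closed_atLeast, of "\<rho> + 1"]
    by (simp add: S_def vimage_def Int_def)
  moreover have "t \<in> S" using neg t by (auto simp: S_def)
  moreover have "bounded S" by (rule bounded_subset[of "{0..D}"]) (auto simp: S_def)
  ultimately obtain s where s: "s \<in> S" and min: "\<And>r. r \<in> S \<Longrightarrow> s \<le> r"
    using compact_attains_inf[of S] by (auto simp: compact_eq_bounded_closed)
  have int: "((\<lambda>r. f (?x r, u r)) has_integral (?x s - xi)) {0..s}"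
    using is_solution_onD[OF flow_solution_on[OF u, of xi s], of s] s by (auto simp: S_def)
  have B0: "0 \<le> B" using B[of xi "u 0"] xi inputsD(2)[OF u] norm_ge_zero
    by (smt (verit, best))
  \<comment> \<open>At the exit time \<open>s\<close> itself the norm is only known to be at least
    \<open>\<rho> + 1\<close>, so this one point is exempted from the bound on the
    integrand.\<close>
  have "norm (f (?x r, u r)) \<le> B" if "r \<in> {0..s} - {s}" for r
  proof (rule B)
    show "norm (?x r) \<le> \<rho> + 1"
      using min[of r] that s by (force simp: S_def)
  qed (rule inputsD(2)[OF u])
  then have "norm (?x s - xi) \<le> B * s"
    using has_integral_bound_spike_finite[OF B0, of "{s}" "\<lambda>r. f (?x r, u r)" "?x s - xi" 0 s] int s
    by (auto simp: S_def)
  also have "\<dots> \<le> B * D" using s B0 by (auto simp: S_def intro: mult_left_mono)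
  finally have "norm (?x s - xi) < 1" using BD by simp
  then have "norm (?x s) < \<rho> + 1" using xi norm_triangle_sub[of "?x s" xi] by linarith
  then show False using s by (simp add: S_def)
qed

lemma short_time:
  obtains D where "D > 0"
    and "\<And>xi u t. norm xi \<le> \<rho> \<Longrightarrow> u \<in> inputs R \<Longrightarrow> t \<in> {0..D} \<Longrightarrow> norm (flow u xi t) \<le> \<rho> + 1"
    and "\<And>xi eta u. norm xi \<le> \<rho> \<Longrightarrow> norm eta \<le> \<rho> \<Longrightarrow> u \<in> inputs R \<Longrightarrow>
      norm ((flow u xi D - xi) - (flow u eta D - eta)) \<le> norm (xi - eta) / 2"
proof -
  let ?K = "cball 0 (\<rho> + 1) \<times> cball 0 R :: ('n \<times> 'm) set"
  have K: "compact ?K" by (intro compact_Times compact_cball)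
  obtain L where L: "L-lipschitz_on ?K f" using loc_lipschitz_compact[OF lip K] .
  have L0: "0 \<le> L" using lipschitz_on_nonneg[OF L] .
  obtain B where B: "B > 0" "\<And>p. p \<in> ?K \<Longrightarrow> norm (f p) \<le> B"
    using compact_continuous_image[OF loc_lipschitz_continuous_on[OF lip] K]
    by (metis compact_imp_bounded bounded_pos imageI)
  \<comment> \<open>The first term keeps trajectories in the larger ball. The second gives
    \<open>L * D \<le> 1/4\<close>: Gronwall's factor is then at most 2, and the increments differ
    by at most \<open>1/4 * 2\<close> times the initial distance. The summand 1 in
    \<open>L + 1\<close> covers \<open>L = 0\<close>.\<close>
  define D where "D = min (1 / (2 * B)) (1 / (4 * (L + 1)))"
  have D: "D > 0" using B(1) L0 by (simp add: D_def)
  have BD: "B * D < 1"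
  proof -
    have "B * D \<le> B * (1 / (2 * B))" using B(1) by (intro mult_left_mono) (auto simp: D_def)
    then show ?thesis using B(1) by simp
  qed
  have LD: "L * D \<le> 1/4"
  proof -
    have "L * D \<le> (L + 1) * (1 / (4 * (L + 1)))" using L0 D by (intro mult_mono) (auto simp: D_def)
    also have "\<dots> = 1/4" using L0 by (simp add: field_simps)
    finally show ?thesis .
  qed
  have bd: "norm (flow u xi t) \<le> \<rho> + 1"
    if "norm xi \<le> \<rho>" "u \<in> inputs R" "t \<in> {0..D}" for xi u t
    by (rule short_time_bound[OF _ BD that]) (use B(2) in auto)
  have "norm ((flow u xi D - xi) - (flow u eta D - eta)) \<le> norm (xi - eta) / 2"
    if xi: "norm xi \<le> \<rho>" and eta: "norm eta \<le> \<rho>" and u: "u \<in> inputs R" for xi eta u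
  proof -
    let ?x = "flow u xi" and ?y = "flow u eta"
    have le: "norm (f (?x s, u s) - f (?y s, u s)) \<le> L * norm (?x s - ?y s)" if "s \<in> {0..D}" for s
      by (rule lipschitz_on_fst_arg[OF L])
        (use bd[OF xi u that] bd[OF eta u that] inputsD(2)[OF u] in auto)
    have "norm (?x s - ?y s) \<le> norm (xi - eta) * 2" if s: "s \<in> {0..D}" for s
    proof -
      have "L * s \<le> 1/4" using LD mult_left_mono[OF _ L0, of s D] s by auto
      then have "exp (L * s) \<le> exp (1/4)" by simp
      also have "\<dots> \<le> 2" using exp_bound[of "1/4"] by (simp add: power2_eq_square)
      finally have "norm (xi - eta) * exp (L * s) \<le> norm (xi - eta) * 2"
        by (rule mult_left_mono) simp
      then show ?thesis
        using solution_dependence[OF flow_solution_on[OF u] flow_solution_on[OF u] L0 le s] by linarith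
    qed
    then have "integral {0..D} (\<lambda>s. norm (?x s - ?y s)) \<le> integral {0..D} (\<lambda>s. norm (xi - eta) * 2)"
      by (intro integral_le integrable_continuous_real continuous_intros flow_continuous[OF u]) auto
    also have "\<dots> = D * (norm (xi - eta) * 2)" using D by simp
    finally have "L * integral {0..D} (\<lambda>s. norm (?x s - ?y s)) \<le> L * (D * (norm (xi - eta) * 2))"
      using L0 by (rule mult_left_mono)
    also have "\<dots> = (L * D) * (norm (xi - eta) * 2)" by simp
    also have "\<dots> \<le> 1/4 * (norm (xi - eta) * 2)" using LD by (intro mult_right_mono) auto
    finally have "L * integral {0..D} (\<lambda>s. norm (?x s - ?y s)) \<le> norm (xi - eta) / 2" by simp
    moreover have "norm ((?x D - xi) - (?y D - eta)) \<le> L * integral {0..D} (\<lambda>s. norm (?x s - ?y s))"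
      by (rule solution_increment_diff[OF flow_solution_on[OF u] flow_solution_on[OF u] le])
        (use D in auto)
    ultimately show ?thesis by linarith
  qed
  from that[OF D bd this] show thesis by blast
qed

section \<open>Propagation of unboundedness along short steps\<close>

text \<open>Trajectories may start anywhere near \<open>eta\<close> rather than at
  \<open>eta\<close> itself; this is what makes the property pass to limit points.\<close>

definition escapes :: "real \<Rightarrow> 'n \<Rightarrow> real \<Rightarrow> bool" where
  "escapes R eta T \<longleftrightarrow> (\<forall>e>0. \<forall>N. \<exists>xi u t.
    dist xi eta < e \<and> u \<in> inputs R \<and> t \<in> {0..T} \<and> norm (flow u xi t) > N)"

text \<open>Very large trajectories become large only after time \<open>D\<close>, so their states
  at time \<open>D\<close> stay in a ball and accumulate at some \<open>eta'\<close>, from which the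
  remaining pieces still escape. Contractivity lets the initial states be replaced by
  \<open>eta\<close> at a small cost.\<close>

lemma escapes_step:
  assumes esc: "escapes R eta T" and D: "D > 0"
    and bd: "\<And>xi u t. xi \<in> cball eta 1 \<Longrightarrow> u \<in> inputs R \<Longrightarrow> t \<in> {0..D} \<Longrightarrow> norm (flow u xi t) \<le> B"
    and contr: "\<And>xi zeta u. xi \<in> cball eta 1 \<Longrightarrow> zeta \<in> cball eta 1 \<Longrightarrow> u \<in> inputs R \<Longrightarrow>
      norm ((flow u xi D - xi) - (flow u zeta D - zeta)) \<le> norm (xi - zeta) / 2"
  shows "D < T"
    and "\<exists>eta'. escapes R eta' (T - D) \<and> (\<forall>e>0. \<exists>u\<in>inputs R. dist (flow u eta D) eta' < e)"
proof -
  \<comment> \<open>The threshold \<open>real k\<close> makes the trajectories unbounded, and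
    \<open>B\<close> forces the large value to occur after time \<open>D\<close>.\<close>
  have "\<exists>xi u t. dist xi eta < 1 / (real k + 1) \<and> u \<in> inputs R \<and> t \<in> {0..T} \<and>
    norm (flow u xi t) > max (real k) B" for k
  proof -
    have "0 < 1 / (real k + 1)" by simp
    then show ?thesis using esc unfolding escapes_def by blast
  qed
  then obtain xi u t where xi: "\<And>k. dist (xi k) eta < 1 / (real k + 1)" and u: "\<And>k. u k \<in> inputs R"
    and t: "\<And>k. t k \<in> {0..T}" and large: "\<And>k. norm (flow (u k) (xi k) (t k)) > max (real k) B"
    by metis
  have xi1: "xi k \<in> cball eta 1" for k
  proof -
    have "1 / (real k + 1) \<le> 1" by simp
    then show ?thesis using xi[of k] unfolding mem_cball dist_commute[of eta] by linarith
  qed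
  have tD: "D < t k" for k
    using bd[OF xi1 u, of "t k" k k] large[of k] t[of k] by fastforce
  show "D < T" using tD[of 0] t[of 0] by simp
  define z where "z k = flow (u k) (xi k) D" for k
  have "z k \<in> cball 0 B" for k
    using bd[OF xi1 u, of D k k] D by (simp add: z_def)
  then obtain eta' r where r: "strict_mono r" and lim: "(z \<circ> r) \<longlonglongrightarrow> eta'"
    using compact_cball[of "0::'n" B] unfolding compact_def by metis
  have rk: "k \<le> r k" for k using r by (rule seq_suble)
  have "escapes R eta' (T - D)"
    unfolding escapes_def
  proof (intro allI impI)
    fix e N :: real assume "e > 0"
    then obtain k0 where k0: "\<And>k. k \<ge> k0 \<Longrightarrow> dist (z (r k)) eta' < e"
      using lim unfolding lim_sequentially by auto
    define k where "k = max k0 (nat \<lceil>N\<rceil>)"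
    have "N \<le> real (r k)" using rk[of k] unfolding k_def by linarith
    moreover have "flow (u (r k)) (xi (r k)) (t (r k)) =
        flow (\<lambda>s. u (r k) (s + D)) (z (r k)) (t (r k) - D)"
      using flow_shift[OF u, of D "t (r k) - D" "r k" "xi (r k)"] D tD[of "r k"] by (simp add: z_def)
    ultimately have "norm (flow (\<lambda>s. u (r k) (s + D)) (z (r k)) (t (r k) - D)) > N"
      using large[of "r k"] by simp
    moreover have "t (r k) - D \<in> {0..T - D}" using t[of "r k"] tD[of "r k"] by auto
    moreover have "dist (z (r k)) eta' < e" by (rule k0) (simp add: k_def)
    ultimately show "\<exists>xi u t. dist xi eta' < e \<and> u \<in> inputs R \<and> t \<in> {0..T - D} \<and> norm (flow u xi t) > N"
      using inputs_shift[OF u] by blast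
  qed
  moreover have "\<exists>u\<in>inputs R. dist (flow u eta D) eta' < e" if e: "e > 0" for e
  proof -
    obtain k1 where k1: "\<And>k. k \<ge> k1 \<Longrightarrow> dist (z (r k)) eta' < e / 2"
      using lim e unfolding lim_sequentially by (metis comp_apply half_gt_zero)
    obtain k2 :: nat where k2: "4 / e < real k2" using reals_Archimedean2 by blast
    define k where "k = max k1 k2"
    have "4 / e < real (r k) + 1" using k2 rk[of k] unfolding k_def by linarith
    then have "1 / (real (r k) + 1) < e / 4" using e by (simp add: field_simps)
    then have x: "norm (xi (r k) - eta) < e / 4" using xi[of "r k"] by (simp add: dist_norm)
    \<comment> \<open>Moving the initial state to \<open>eta\<close> costs at most 3/2 of its
      distance, which is below \<open>e/4\<close>; the result is less than
      \<open>e/2\<close>.\<close>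
    have "norm (flow (u (r k)) eta D - z (r k)) =
        norm (((flow (u (r k)) eta D - eta) - (z (r k) - xi (r k))) - (xi (r k) - eta))"
      by (simp add: algebra_simps)
    also have "\<dots> \<le> norm ((flow (u (r k)) eta D - eta) - (z (r k) - xi (r k))) + norm (xi (r k) - eta)"
      by (rule norm_triangle_ineq4)
    also have "\<dots> \<le> norm (eta - xi (r k)) / 2 + norm (xi (r k) - eta)"
      using contr[of eta "xi (r k)" "u (r k)"] xi1 u by (simp add: z_def)
    also have "\<dots> < e / 2" using x norm_ge_zero[of "xi (r k) - eta"]
      unfolding norm_minus_commute[of eta] by linarith
    finally have "dist (flow (u (r k)) eta D) eta' < e"
      using k1[of k] dist_triangle[of "flow (u (r k)) eta D" eta' "z (r k)"]
      by (simp add: dist_norm k_def)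
    then show ?thesis using u by blast
  qed
  ultimately show "\<exists>eta'. escapes R eta' (T - D) \<and> (\<forall>e>0. \<exists>u\<in>inputs R. dist (flow u eta D) eta' < e)"
    by blast
qed

end

section \<open>Infinite concatenations and shadowing\<close>

text \<open>Splicing at \<open>\<tau> k\<close> changes nothing before that time, so the inputs
  \<open>v k\<close> stabilise below each \<open>\<tau> k\<close>. Their limit \<open>w\<close> is
  measurable as a pointwise limit, and it is 0 at times beyond every
  \<open>\<tau> k\<close>.\<close>

lemma concatenated_input:
  fixes \<tau> :: "nat \<Rightarrow> real" and u :: "nat \<Rightarrow> real \<Rightarrow> 'm::euclidean_space"
  assumes \<tau>: "mono \<tau>" and u: "\<And>k. u k \<in> inputs R"
    and v0: "v 0 \<in> inputs R" and vS: "\<And>k. v (Suc k) = splice (\<tau> k) (v k) (u k)"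
  obtains w where "w \<in> inputs R" "\<And>k t. t < \<tau> k \<Longrightarrow> w t = v k t"
proof -
  have v: "v k \<in> inputs R" for k
    by (induction k) (auto simp: v0 vS intro: inputs_splice u)
  have stable: "v j t = v k t" if "k \<le> j" "t < \<tau> k" for j k t
    using that(1)
  proof (induction j rule: dec_induct)
    case (step j)
    then have "t < \<tau> j" using that(2) monoD[OF \<tau>, of k j] by linarith
    then show ?case using step by (simp add: vS splice_def)
  qed simp
  define w where "w t = (if \<exists>k. t < \<tau> k then v (LEAST k. t < \<tau> k) t else 0)" for t
  have w: "w t = v k t" if "t < \<tau> k" for k t
  proof -
    let ?l = "LEAST k. t < \<tau> k"
    have "t < \<tau> ?l" using that by (rule LeastI)
    moreover have "?l \<le> k" using that by (rule Least_le)
    ultimately have "v k t = v ?l t" by (intro stable)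
    then show ?thesis using that by (auto simp: w_def)
  qed
  \<comment> \<open>Cutting off at \<open>\<tau> k\<close> gives convergence also at times that no
    \<open>\<tau> k\<close> exceeds.\<close>
  define g where "g k t = (if t < \<tau> k then v k t else 0)" for k t
  have "w \<in> borel_measurable lebesgue"
  proof (rule borel_measurable_LIMSEQ_metric)
    show "g k \<in> borel_measurable lebesgue" for k
      unfolding g_def using inputsD(1)[OF v] by (intro measurable_If) auto
    show "(\<lambda>k. g k t) \<longlonglongrightarrow> w t" for t
    proof (cases "\<exists>k. t < \<tau> k")
      case True
      then obtain k where k: "t < \<tau> k" ..
      have "g j t = w t" if "k \<le> j" for j
        using k w[of t j] monoD[OF \<tau> that] by (simp add: g_def)
      then have "\<forall>\<^sub>F j in sequentially. g j t = w t" by (rule eventually_sequentiallyI)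
      then show ?thesis by (rule tendsto_eventually)
    qed (simp add: g_def w_def)
  qed
  moreover have "norm (w t) \<le> R" for t
    using inputsD(2)[OF v] inputs_nonneg[OF v0] by (simp add: w_def)
  ultimately have "w \<in> inputs R" by (simp add: inputs_def)
  then show thesis using that w by blast
qed

text \<open>Each approximate orbit has true orbits near it of any finite length; these are found by pulling
  back from the end, and compactness of the first ball yields an infinite one.\<close>
lemma shadowing:
  fixes \<Phi> :: "nat \<Rightarrow> 'a::euclidean_space \<Rightarrow> 'a" and \<eta> :: "nat \<Rightarrow> 'a"
  assumes contr: "\<And>k x y. x \<in> cball (\<eta> k) 1 \<Longrightarrow> y \<in> cball (\<eta> k) 1 \<Longrightarrow>
      norm ((\<Phi> k x - x) - (\<Phi> k y - y)) \<le> norm (x - y) / 2"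
    and close: "\<And>k. dist (\<Phi> k (\<eta> k)) (\<eta> (Suc k)) \<le> (1/4) ^ Suc k"
  obtains z where "\<And>k. z (Suc k) = \<Phi> k (z k)" "\<And>k. dist (z k) (\<eta> k) \<le> 1"
proof -
  define Z where "Z x k = rec_nat x \<Phi> k" for x k
  have Z0: "Z x 0 = x" and ZS: "Z x (Suc k) = \<Phi> k (Z x k)" for x k by (simp_all add: Z_def)
  \<comment> \<open>With these radii, the tolerance on \<open>w\<close> plus the step error is
    \<open>2 * (1/4) ^ Suc K = r K / 2\<close>, exactly what local inversion on the ball of radius
    \<open>r K\<close> permits.\<close>
  define r :: "nat \<Rightarrow> real" where "r k = (1/4) ^ k" for k
  have r1: "r k \<le> 1" for k by (simp add: r_def power_le_one)
  have ball1: "x \<in> cball (\<eta> k) 1" if "x \<in> cball (\<eta> k) (r k)" for x k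
    using that r1[of k] by auto
  have finite_shadow: "\<exists>x. Z x K = w \<and> (\<forall>k\<le>K. Z x k \<in> cball (\<eta> k) (r k))"
    if "w \<in> cball (\<eta> K) (r K)" for K w
    using that
  proof (induction K arbitrary: w)
    case 0
    then show ?case by (intro exI[of _ w]) (simp add: Z0)
  next
    case (Suc K)
    have "norm (w - \<Phi> K (\<eta> K)) \<le> dist w (\<eta> (Suc K)) + dist (\<Phi> K (\<eta> K)) (\<eta> (Suc K))"
      using dist_triangle2 by (simp add: dist_norm[symmetric] del: dist_norm)
    also have "\<dots> \<le> r (Suc K) + (1/4) ^ Suc K"
      using Suc.prems close[of K] by (intro add_mono) (auto simp: dist_commute)
    also have "\<dots> = r K / 2" by (simp add: r_def)
    finally have "norm (w - \<Phi> K (\<eta> K)) \<le> r K / 2" .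
    then obtain w' where w': "w' \<in> cball (\<eta> K) (r K)" "\<Phi> K w' = w"
      using near_identity_onto_cball[of "\<eta> K" "r K" "\<Phi> K" w] contr ball1 by metis
    from Suc.IH[OF w'(1)] obtain x where "Z x K = w'" "\<forall>k\<le>K. Z x k \<in> cball (\<eta> k) (r k)" by blast
    with w'(2) Suc.prems show ?case by (intro exI[of _ x]) (auto simp: ZS le_Suc_eq)
  qed
  have "\<exists>x. \<forall>k\<le>K. Z x k \<in> cball (\<eta> k) (r k)" for K
    using finite_shadow[of "\<eta> K" K] by (auto simp: r_def)
  then obtain X where X: "\<And>K k. k \<le> K \<Longrightarrow> Z (X K) k \<in> cball (\<eta> k) (r k)" by metis
  have "X K \<in> cball (\<eta> 0) (r 0)" for K using X[of 0 K] by (simp add: Z0)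
  then obtain x s where s: "strict_mono s" and lim: "(X \<circ> s) \<longlonglongrightarrow> x"
    using compact_cball[of "\<eta> 0" "r 0"] unfolding compact_def by metis
  \<comment> \<open>Convergence and membership are proved together, since \<open>\<Phi> k\<close> is
    known to be continuous only on the ball around \<open>\<eta> k\<close>.\<close>
  have "(\<lambda>i. Z (X (s i)) k) \<longlonglongrightarrow> Z x k \<and> Z x k \<in> cball (\<eta> k) (r k)" for k
  proof (induction k)
    case 0
    have "(\<lambda>i. Z (X (s i)) 0) \<longlonglongrightarrow> Z x 0" using lim by (simp add: Z0 comp_def)
    moreover have "Z x 0 \<in> cball (\<eta> 0) (r 0)"
      by (rule Lim_in_closed_set[OF closed_cball _ _ calculation]) (auto simp: X[of 0, simplified])
    ultimately show ?case ..
  next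
    case (Suc k)
    have cont: "continuous_on (cball (\<eta> k) 1) (\<Phi> k)"
    proof (rule lipschitz_on_continuous_on[of 2], rule lipschitz_onI)
      fix a b assume "a \<in> cball (\<eta> k) 1" "b \<in> cball (\<eta> k) 1"
      then have "norm ((\<Phi> k a - a) - (\<Phi> k b - b)) \<le> norm (a - b) / 2" by (rule contr)
      moreover have "norm (\<Phi> k a - \<Phi> k b) \<le> norm ((\<Phi> k a - a) - (\<Phi> k b - b)) + norm (a - b)"
        using norm_triangle_ineq[of "(\<Phi> k a - a) - (\<Phi> k b - b)" "a - b"] by simp
      ultimately show "dist (\<Phi> k a) (\<Phi> k b) \<le> 2 * dist a b"
        using norm_ge_zero[of "a - b"] unfolding dist_norm by linarith
    qed simp
    have ev: "\<forall>\<^sub>F i in sequentially. Z (X (s i)) j \<in> cball (\<eta> j) (r j)" for j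
      using X[of j] seq_suble[OF s] by (intro eventually_sequentiallyI[of j]) (meson order_trans)
    have lim: "(\<lambda>i. Z (X (s i)) (Suc k)) \<longlonglongrightarrow> Z x (Suc k)"
      unfolding ZS using Suc ball1
      by (intro continuous_on_tendsto_compose[OF cont]) (auto intro: eventually_mono[OF ev[of k]])
    moreover have "Z x (Suc k) \<in> cball (\<eta> (Suc k)) (r (Suc k))"
      by (rule Lim_in_closed_set[OF closed_cball ev _ lim]) simp
    ultimately show ?case ..
  qed
  then have "dist (Z x k) (\<eta> k) \<le> 1" for k using ball1 by (metis mem_cball dist_commute)
  with ZS show thesis by (rule that)
qed

section \<open>No state escapes in finite time\<close>

context complete_system
begin

text \<open>The iterated steps would have lengths summing to less than \<open>T0\<close>. The
  shadowing trajectory, however, is bounded on \<open>{0..T0}\<close> and keeps the approximate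
  orbit in a ball where step lengths are bounded below.\<close>

lemma not_escapes: "\<not> escapes R eta0 T0"
proof
  assume esc0: "escapes R eta0 T0"
  have "\<forall>n::nat. \<exists>D>0.
     (\<forall>xi u t. norm xi \<le> real n + 1 \<longrightarrow> u \<in> inputs R \<longrightarrow> t \<in> {0..D} \<longrightarrow>
       norm (flow u xi t) \<le> (real n + 1) + 1) \<and>
     (\<forall>xi eta u. norm xi \<le> real n + 1 \<longrightarrow> norm eta \<le> real n + 1 \<longrightarrow> u \<in> inputs R \<longrightarrow>
      norm ((flow u xi D - xi) - (flow u eta D - eta)) \<le> norm (xi - eta) / 2)"
    using short_time by (metis (no_types, lifting))
  then obtain \<delta> where \<delta>: "\<And>n::nat. \<delta> n > 0"
    and bd: "\<And>n xi u t. norm xi \<le> real n + 1 \<Longrightarrow> u \<in> inputs R \<Longrightarrow> t \<in> {0..\<delta> n} \<Longrightarrow>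
      norm (flow u xi t) \<le> (real n + 1) + 1"
    and contr: "\<And>n xi eta u. norm xi \<le> real n + 1 \<Longrightarrow> norm eta \<le> real n + 1 \<Longrightarrow> u \<in> inputs R \<Longrightarrow>
      norm ((flow u xi (\<delta> n) - xi) - (flow u eta (\<delta> n) - eta)) \<le> norm (xi - eta) / 2"
    by metis
  \<comment> \<open>Rounding the norm up to an integer leaves only finitely many step lengths on any
    bounded set, hence a positive minimum there.\<close>
  define d where "d eta = \<delta> (nat \<lceil>norm eta\<rceil>)" for eta :: 'n
  have d_pos: "d eta > 0" for eta using \<delta> by (simp add: d_def)
  have cball: "norm xi \<le> real (nat \<lceil>norm eta\<rceil>) + 1" if "xi \<in> cball eta 1" for xi eta :: 'n
    using that norm_triangle_sub[of xi eta] real_nat_ceiling_ge[of "norm eta"]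
    unfolding mem_cball dist_norm norm_minus_commute[of eta] by linarith
  have d_contr: "norm ((flow u xi (d eta) - xi) - (flow u zeta (d eta) - zeta)) \<le> norm (xi - zeta) / 2"
    if "xi \<in> cball eta 1" "zeta \<in> cball eta 1" "u \<in> inputs R" for xi zeta eta u
    unfolding d_def by (rule contr[OF cball[OF that(1)] cball[OF that(2)] that(3)])
  have step: "d eta < T"
    "\<exists>eta'. escapes R eta' (T - d eta) \<and> (\<forall>e>0. \<exists>u\<in>inputs R. dist (flow u eta (d eta)) eta' < e)"
    if "escapes R eta T" for eta T
    using escapes_step[OF that d_pos _ d_contr] bd[OF cball] unfolding d_def by blast+

  \<comment> \<open>Dependent choice on pairs of a state and the time left; the error
    \<open>(1/4) ^ Suc k\<close> is the one \<open>shadowing\<close> tolerates.\<close>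
  have "\<exists>s. (\<forall>k::nat. escapes R (fst (s k)) (snd (s k))) \<and>
      (\<forall>k. snd (s (Suc k)) = snd (s k) - d (fst (s k)) \<and>
      (\<exists>u\<in>inputs R. dist (flow u (fst (s k)) (d (fst (s k)))) (fst (s (Suc k))) < (1/4) ^ Suc k)) \<and>
      s 0 = (eta0, T0)"
  proof -
    have "\<exists>s. \<forall>k::nat. (escapes R (fst (s k)) (snd (s k)) \<and> (k = 0 \<longrightarrow> s k = (eta0, T0))) \<and>
      (snd (s (Suc k)) = snd (s k) - d (fst (s k)) \<and>
      (\<exists>u\<in>inputs R. dist (flow u (fst (s k)) (d (fst (s k)))) (fst (s (Suc k))) < (1/4) ^ Suc k))"
    proof (intro dependent_nat_choice)
      show "\<exists>s. escapes R (fst s) (snd s) \<and> (0 = (0::nat) \<longrightarrow> s = (eta0, T0))"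
        using esc0 by auto
    next
      fix s and k :: nat assume "escapes R (fst s) (snd s) \<and> (k = 0 \<longrightarrow> s = (eta0, T0))"
      then obtain eta' where e': "escapes R eta' (snd s - d (fst s))"
          and app: "\<forall>e>0. \<exists>u\<in>inputs R. dist (flow u (fst s) (d (fst s))) eta' < e"
        using step(2) by blast
      have "\<exists>u\<in>inputs R. dist (flow u (fst s) (d (fst s))) eta' < (1/4) ^ Suc k"
        using app by (metis zero_less_power zero_less_divide_1_iff zero_less_numeral)
      with e' show "\<exists>s'. (escapes R (fst s') (snd s') \<and> (Suc k = 0 \<longrightarrow> s' = (eta0, T0))) \<and>
          snd s' = snd s - d (fst s) \<and>
          (\<exists>u\<in>inputs R. dist (flow u (fst s) (d (fst s))) (fst s') < (1/4) ^ Suc k)"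
        by (intro exI[of _ "(eta', snd s - d (fst s))"]) simp
    qed
    then show ?thesis by metis
  qed
  then obtain s :: "nat \<Rightarrow> 'n \<times> real" where esc: "\<And>k. escapes R (fst (s k)) (snd (s k))"
    and T: "\<And>k. snd (s (Suc k)) = snd (s k) - d (fst (s k))" and s0: "s 0 = (eta0, T0)"
    and ex_u: "\<And>k. \<exists>u\<in>inputs R.
      dist (flow u (fst (s k)) (d (fst (s k)))) (fst (s (Suc k))) < (1/4) ^ Suc k"
    by blast
  define \<eta> where "\<eta> k = fst (s k)" for k
  from ex_u obtain u where u: "\<And>k. u k \<in> inputs R"
    and close: "\<And>k. dist (flow (u k) (\<eta> k) (d (\<eta> k))) (\<eta> (Suc k)) < (1/4) ^ Suc k"
    unfolding \<eta>_def by metis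
  define \<tau> where "\<tau> k = (\<Sum>j<k. d (\<eta> j))" for k
  have "snd (s k) = T0 - \<tau> k" for k
    by (induction k) (simp_all add: s0 T \<tau>_def \<eta>_def)
  then have \<tau>_less: "\<tau> k < T0" for k
    using step(1)[OF esc, of k] d_pos[of "fst (s k)"] by simp
  have \<tau>_mono: "mono \<tau>"
    unfolding \<tau>_def by (intro monoI sum_mono2 less_imp_le[OF d_pos]) auto
  have \<tau>_nonneg: "0 \<le> \<tau> k" for k
    unfolding \<tau>_def by (intro sum_nonneg less_imp_le[OF d_pos])

  obtain z where zS: "\<And>k. z (Suc k) = flow (u k) (z k) (d (\<eta> k))" and z: "\<And>k. dist (z k) (\<eta> k) \<le> 1"
    by (rule shadowing[of \<eta> "\<lambda>k x. flow (u k) x (d (\<eta> k))"])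
      (use d_contr u close in \<open>auto intro: less_imp_le simp del: power_Suc\<close>)
  \<comment> \<open>Applying each \<open>u j\<close> for its step length steers \<open>z 0\<close>
    through all \<open>z k\<close>, with \<open>z k\<close> reached at time
    \<open>\<tau> k\<close>.\<close>
  define v where "v k = rec_nat (\<lambda>_. 0) (\<lambda>k v. splice (\<tau> k) v (u k)) k" for k
  have v0: "v 0 = (\<lambda>_. 0)" and vS: "v (Suc k) = splice (\<tau> k) (v k) (u k)" for k
    by (simp_all add: v_def)
  have v0_in: "v 0 \<in> inputs R" unfolding v0 by (rule zero_input[OF inputs_nonneg[OF u]])
  have v: "v k \<in> inputs R" for k
    by (induction k) (auto simp: v0_in vS intro: inputs_splice u)
  have zv: "flow (v k) (z 0) (\<tau> k) = z k" for k
  proof (induction k)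
    case (Suc k)
    have "\<tau> (Suc k) = d (\<eta> k) + \<tau> k" by (simp add: \<tau>_def)
    then show ?case
      using flow_splice[OF v[of k] u[of k] \<tau>_nonneg[of k] less_imp_le[OF d_pos], of "z 0" "\<eta> k"] Suc
      by (simp add: vS zS)
  qed (simp add: \<tau>_def flow_0[OF v0_in])
  obtain w where w: "w \<in> inputs R" and wv: "\<And>k t. t < \<tau> k \<Longrightarrow> w t = v k t"
    using concatenated_input[of \<tau> u R v] \<tau>_mono u v0_in vS by metis
  have zw: "flow w (z 0) (\<tau> k) = z k" for k
    using flow_cong[OF w v[of k], of "\<tau> k" "\<tau> k"] wv[of _ k] \<tau>_nonneg[of k] zv by simp

  \<comment> \<open>Forward completeness enters here: the concatenated input has a solution on all
    of \<open>{0..T0}\<close>, which contains every \<open>\<tau> k\<close>.\<close>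
  have "bounded (flow w (z 0) ` {0..T0})"
    by (intro compact_imp_bounded compact_continuous_image flow_continuous[OF w]) auto
  then obtain B where B: "\<And>t. t \<in> {0..T0} \<Longrightarrow> norm (flow w (z 0) t) \<le> B"
    by (meson bounded_iff imageI)
  have \<eta>_bd: "norm (\<eta> k) \<le> B + 1" for k
    using B[of "\<tau> k"] \<tau>_nonneg[of k] \<tau>_less[of k] zw[of k] z[of k] norm_triangle_sub[of "\<eta> k" "z k"]
    by (simp add: dist_norm norm_minus_commute)
  define m where "m = Min (\<delta> ` {..nat \<lceil>B + 1\<rceil>})"
  have m: "m > 0" using \<delta> by (simp add: m_def)
  have "m \<le> d (\<eta> k)" for k
    unfolding m_def d_def using nat_mono[OF ceiling_mono[OF \<eta>_bd[of k]]] by (intro Min_le) blast+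
  then have "real k * m \<le> \<tau> k" for k
    using sum_bounded_below[of "{..<k}" m "\<lambda>j. d (\<eta> j)"] by (simp add: \<tau>_def)
  then have "real k * m < T0" for k using \<tau>_less[of k] by (meson le_less_trans)
  then show False using reals_Archimedean3[OF m] by (meson less_asym)
qed

text \<open>Otherwise initial states of ever larger trajectories accumulate at a point of
  \<open>C\<close>, and that point escapes.\<close>

theorem reachable_set_bounded:
  assumes "compact C"
  obtains B where "\<And>xi u t. xi \<in> C \<Longrightarrow> u \<in> inputs R \<Longrightarrow> t \<in> {0..T} \<Longrightarrow> norm (flow u xi t) \<le> B"
proof (rule ccontr)
  assume "\<not> thesis"
  then have "\<exists>xi u t. xi \<in> C \<and> u \<in> inputs R \<and> t \<in> {0..T} \<and> norm (flow u xi t) > real k" for k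
    using that by (metis not_le)
  then obtain xi u t where xi: "\<And>k. xi k \<in> C" and u: "\<And>k. u k \<in> inputs R" and t: "\<And>k. t k \<in> {0..T}"
    and large: "\<And>k. norm (flow (u k) (xi k) (t k)) > real k"
    by metis
  from assms xi obtain eta r where r: "strict_mono r" and lim: "(xi \<circ> r) \<longlonglongrightarrow> eta"
    unfolding compact_def by metis
  have "escapes R eta T"
    unfolding escapes_def
  proof (intro allI impI)
    fix e N :: real assume "e > 0"
    then obtain k0 where k0: "\<And>k. k \<ge> k0 \<Longrightarrow> dist (xi (r k)) eta < e"
      using lim unfolding lim_sequentially by auto
    define k where "k = max k0 (nat \<lceil>N\<rceil>)"
    have "N \<le> real (r k)" using seq_suble[OF r, of k] unfolding k_def by linarith
    then have "norm (flow (u (r k)) (xi (r k)) (t (r k))) > N" using large[of "r k"] by simp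
    moreover have "dist (xi (r k)) eta < e" by (rule k0) (simp add: k_def)
    ultimately show "\<exists>xi u t. dist xi eta < e \<and> u \<in> inputs R \<and> t \<in> {0..T} \<and> norm (flow u xi t) > N"
      using u t by blast
  qed
  then show False using not_escapes by blast
qed

end

section \<open>Comparison functions\<close>

lemma classK_mono: "classK g \<Longrightarrow> 0 \<le> a \<Longrightarrow> a \<le> b \<Longrightarrow> g a \<le> g b"
  using strict_mono_on_leD[of "{0..}" g a b] by (simp add: classK_def)

lemma classK_nonneg: "classK g \<Longrightarrow> 0 \<le> a \<Longrightarrow> 0 \<le> g a"
  using classK_mono[of g 0 a] by (simp add: classK_def)

lemma classK_0: "classK g \<Longrightarrow> g 0 = 0"
  by (simp add: classK_def)

lemma classK_compose:
  assumes "classK g" "classK k"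
  shows "classK (\<lambda>s. g (k s))"
proof -
  have "k ` {0..} \<subseteq> {0..}" using classK_nonneg[OF assms(2)] by auto
  then have "continuous_on {0..} (\<lambda>s. g (k s))"
    using assms unfolding classK_def by (blast intro: continuous_on_compose2[of "{0..}" g "{0..}" k])
  moreover have "strict_mono_on {0..} (\<lambda>s. g (k s))"
    using assms classK_nonneg[OF assms(2)] by (auto simp: classK_def strict_mono_on_def)
  ultimately show ?thesis using assms by (simp add: classK_def)
qed

lemma classK_scale: "0 < c \<Longrightarrow> classK (\<lambda>s. c * s)"
  unfolding classK_def strict_mono_on_def by (auto intro!: continuous_intros)

lemma classK_add: "classK g \<Longrightarrow> classK k \<Longrightarrow> classK (\<lambda>s. g s + k s)"
  unfolding classK_def strict_mono_on_def by (auto intro!: continuous_intros add_strict_mono)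

text \<open>A sum is at most twice its larger summand. This separates the state and input
  contributions inside a comparison function.\<close>

lemma classK_subadd:
  assumes "classK g" "0 \<le> a" "0 \<le> b"
  shows "g (a + b) \<le> max (g (2 * a)) (g (2 * b))"
proof (cases "a \<le> b")
  case True
  then show ?thesis using classK_mono[OF assms(1), of "a + b" "2 * b"] assms by simp
next
  case False
  then show ?thesis using classK_mono[OF assms(1), of "a + b" "2 * a"] assms by simp
qed

lemma classKL_classK: "classKL b \<Longrightarrow> 0 \<le> t \<Longrightarrow> classK (\<lambda>s. b s t)"
  by (simp add: classKL_def)

lemma classKL_antimono: "classKL b \<Longrightarrow> 0 \<le> s \<Longrightarrow> 0 \<le> t1 \<Longrightarrow> t1 \<le> t2 \<Longrightarrow> b s t2 \<le> b s t1"
  unfolding classKL_def by blast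

lemma classKL_nonneg: "classKL b \<Longrightarrow> 0 \<le> s \<Longrightarrow> 0 \<le> t \<Longrightarrow> 0 \<le> b s t"
  using classK_nonneg[OF classKL_classK] by blast

lemma classKL_compose:
  assumes g: "classK g" and b: "classKL b"
  shows "classKL (\<lambda>s t. g (b s t))"
  unfolding classKL_def
proof (intro conjI allI impI)
  show "classK (\<lambda>s. g (b s t))" if "0 \<le> t" for t
    by (rule classK_compose[OF g classKL_classK[OF b that]])
next
  fix s t1 t2 :: real assume "0 \<le> s" "0 \<le> t1 \<and> t1 \<le> t2"
  then show "g (b s t2) \<le> g (b s t1)"
    by (intro classK_mono[OF g] classKL_nonneg[OF b] classKL_antimono[OF b]) auto
next
  fix s :: real assume s: "0 \<le> s"
  have "((\<lambda>t. g (b s t)) \<longlongrightarrow> g 0) at_top"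
  proof (rule continuous_on_tendsto_compose[of "{0..}" g])
    show "\<forall>\<^sub>F t in at_top. b s t \<in> {0..}"
      using eventually_ge_at_top[of 0] by eventually_elim (use classKL_nonneg[OF b s] in auto)
  qed (use g b s in \<open>auto simp: classK_def classKL_def\<close>)
  then show "((\<lambda>t. g (b s t)) \<longlongrightarrow> 0) at_top" by (simp add: classK_0[OF g])
qed

text \<open>Surjectivity comes from the intermediate value theorem, and continuity of the inverse at
  \<open>r\<close> from trapping arguments between the values of \<open>g\<close> at
  \<open>k r - e\<close> and \<open>k r + e\<close>.\<close>

lemma classKinf_inverse:
  assumes "classKinf g"
  obtains k where "classK k" "\<And>s. 0 \<le> s \<Longrightarrow> k (g s) = s"
proof -
  have K: "classK g" and cont: "continuous_on {0..} g" and sm: "strict_mono_on {0..} g" and g0: "g 0 = 0"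
    using assms by (auto simp: classKinf_def classK_def)
  have "\<exists>s\<ge>0. g s = r" if r: "0 \<le> r" for r
  proof -
    obtain s where "s \<ge> 0" "g s > r" using assms by (auto simp: classKinf_def)
    then show ?thesis
      using IVT'[of g 0 r s] r g0 continuous_on_subset[OF cont, of "{0..s}"] by auto
  qed
  then obtain k where k0: "\<And>r. 0 \<le> r \<Longrightarrow> 0 \<le> k r" and gk: "\<And>r. 0 \<le> r \<Longrightarrow> g (k r) = r" by metis
  have less: "a < b" if "0 \<le> a" "0 \<le> b" "g a < g b" for a b
    using that classK_mono[OF K, of b a] by fastforce
  have kg: "k (g s) = s" if "0 \<le> s" for s
    using less[of "k (g s)" s] less[of s "k (g s)"] that gk[of "g s"] k0[of "g s"] classK_nonneg[OF K that]
      strict_mono_onD[OF sm, of s "k (g s)"] strict_mono_onD[OF sm, of "k (g s)" s]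
    by (cases s "k (g s)" rule: linorder_cases) auto
  have "continuous_on {0..} k"
    unfolding continuous_on_iff
  proof (intro ballI allI impI)
    fix r e :: real assume r: "r \<in> {0..}" and e: "0 < e"
    \<comment> \<open>If \<open>k r < e\<close>, the point \<open>k r - e\<close> lies outside the
      domain, and the lower estimate holds because \<open>k\<close> is nonnegative; the default -1
      then imposes no constraint.\<close>
    define lo where "lo = (if e \<le> k r then g (k r - e) else - 1)"
    have lo: "lo < r"
      using strict_mono_onD[OF sm, of "k r - e" "k r"] gk[of r] r e k0[of r] by (auto simp: lo_def)
    have hi: "r < g (k r + e)"
      using strict_mono_onD[OF sm, of "k r" "k r + e"] gk[of r] r e k0[of r] by auto
    show "\<exists>d>0. \<forall>q\<in>{0..}. dist q r < d \<longrightarrow> dist (k q) (k r) < e"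
    proof (intro exI[of _ "min (r - lo) (g (k r + e) - r)"] conjI ballI impI)
      fix q assume q: "q \<in> {0..}" "dist q r < min (r - lo) (g (k r + e) - r)"
      then have q': "lo < q" "q < g (k r + e)" by (auto simp: dist_real_def)
      have "k q < k r + e" by (rule less) (use q q' r e k0 gk in auto)
      moreover have "k r - e < k q"
      proof (cases "e \<le> k r")
        case True
        then have "g (k r - e) < g (k q)" using q'(1) gk[of q] q(1) by (simp add: lo_def)
        then show ?thesis using less[of "k r - e" "k q"] True k0[of q] q(1) by simp
      next
        case False
        then show ?thesis using k0[of q] q by auto
      qed
      ultimately show "dist (k q) (k r) < e" by (simp add: dist_real_def abs_less_iff)
    qed (use lo hi in auto)
  qed
  moreover have "strict_mono_on {0..} k"
    by (rule strict_mono_onI) (use less k0 gk in auto)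
  moreover have "k 0 = 0" using kg[of 0] g0 by simp
  ultimately have "classK k" by (simp add: classK_def)
  then show thesis using that kg by blast
qed

section \<open>From essential bounds to pointwise bounds\<close>

text \<open>A negative bound fails at every nonnegative time, and these times do not form a null
  set.\<close>

lemma ess_bound_nonneg:
  assumes "ess_bound u M"
  shows "0 \<le> M"
proof (rule ccontr)
  assume "\<not> 0 \<le> M"
  then have "AE t in lebesgue. t \<notin> {0::real..}"
    using norm_ge_zero order_trans
    by (intro eventually_mono[OF assms[unfolded ess_bound_def]]) blast
  then obtain N where "negligible N" "{t. \<not> t \<notin> {0::real..}} \<subseteq> N"
    unfolding eventually_ae_filter_negligible by blast
  then have "negligible {0..1::real}"
    by (elim negligible_subset) auto
  then show False using negligible_interval(1)[of 0 "1::real"] by simp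
qed

lemma ess_bounded_input:
  fixes u :: "real \<Rightarrow> 'm::euclidean_space"
  assumes u: "admissible_input u" and M: "ess_bound u M"
  obtains v N where "v \<in> inputs M" "negligible N" "\<And>t. 0 \<le> t \<Longrightarrow> t \<notin> N \<Longrightarrow> v t = u t"
proof -
  from M obtain N where N: "negligible N" "{t. \<not> (t \<in> {0..} \<longrightarrow> norm (u t) \<le> M)} \<subseteq> N"
    unfolding ess_bound_def eventually_ae_filter_negligible by blast
  \<comment> \<open>Extension by 0 turns measurability on the half-line into measurability on the
    whole line; zeroing where the bound fails then makes the bound pointwise.\<close>
  define u' where "u' t = (if t \<in> {0..} then u t else 0)" for t
  have [measurable]: "u' \<in> borel_measurable lebesgue"
    unfolding u'_def using u
    by (subst measurable_If_restrict_space_iff) (simp_all add: admissible_input_def flip: atLeast_def)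
  define v where "v t = (if norm (u' t) \<le> M then u' t else 0)" for t
  have "v \<in> borel_measurable lebesgue" unfolding v_def by measurable
  then have "v \<in> inputs M" using ess_bound_nonneg[OF M] by (simp add: inputs_def v_def)
  moreover have "v t = u t" if "0 \<le> t" "t \<notin> N" for t
    using that N(2) by (auto simp: v_def u'_def)
  ultimately show thesis using that N(1) by blast
qed

context complete_system
begin

text \<open>Altering the input on a null set keeps the solution, and uniqueness does the rest. Hence
  the stability estimates need to be checked only for \<open>flow\<close> and pointwise bounded
  inputs.\<close>

lemma solution_flow:
  assumes "admissible_input u" "is_global_solution f u xi x" "ess_bound u M"
  obtains v where "v \<in> inputs M" "\<And>t. 0 \<le> t \<Longrightarrow> x t = flow v xi t"
proof -
  obtain v N where v: "v \<in> inputs M" and N: "negligible N" "\<And>t. 0 \<le> t \<Longrightarrow> t \<notin> N \<Longrightarrow> v t = u t"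
    using ess_bounded_input[OF assms(1,3)] by blast
  have "x t = flow v xi t" if t: "0 \<le> t" for t
  proof -
    have "is_solution_on f u xi x t" using assms(2) t by (simp add: is_global_solution_def)
    then have "is_solution_on f v xi x t" by (rule is_solution_on_spike[OF _ N(1)]) (use N(2) in auto)
    then show ?thesis using flow_eqI[OF v, of v xi x t t] t by simp
  qed
  then show thesis using that v by blast
qed

lemma IOS_flowI:
  assumes "classKL \<beta>" "classK \<gamma>"
    and "\<And>xi u (t::real) M. u \<in> inputs M \<Longrightarrow> 0 \<le> t \<Longrightarrow> norm (h (flow u xi t)) \<le> \<beta> (norm xi) t + \<gamma> M"
  shows "IOS f h"
  unfolding IOS_def using assms complete by (metis solution_flow)

lemma OLIOS_flowI:
  assumes "IOS f h" "classK \<sigma>1" "classK \<sigma>2"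
    and "\<And>xi u (t::real) M. u \<in> inputs M \<Longrightarrow> 0 \<le> t \<Longrightarrow> norm (h (flow u xi t)) \<le> max (\<sigma>1 (norm (h xi))) (\<sigma>2 M)"
  shows "OLIOS f h"
  unfolding OLIOS_def using assms by (metis solution_flow)

lemma IOS_flowE:
  assumes "IOS f h"
  obtains \<beta> \<gamma> where "classKL \<beta>" "classK \<gamma>"
    "\<And>xi u (t::real) M. u \<in> inputs M \<Longrightarrow> 0 \<le> t \<Longrightarrow> norm (h (flow u xi t)) \<le> \<beta> (norm xi) t + \<gamma> M"
  using assms unfolding IOS_def
  by (metis flow_solution inputs_admissible inputs_ess_bound)

end

section \<open>Stability passes from a dominating output to the original one\<close>

text \<open>Applying the inverse of \<open>chi\<close> to the estimate for \<open>h0\<close> bounds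
  the original output; \<open>classK_subadd\<close> splits the result into a transient and an input
  term.\<close>

lemma IOS_if_output_dominated:
  fixes f :: "'n::euclidean_space \<times> 'm::euclidean_space \<Rightarrow> 'n"
    and h :: "'n \<Rightarrow> 'y::real_normed_vector" and h0 :: "'n \<Rightarrow> real"
  assumes f: "loc_lipschitz f" and h0: "IOS f h0" and chi: "classKinf chi"
    and le: "\<And>xi. chi (norm (h xi)) \<le> h0 xi"
  shows "IOS f h"
proof -
  interpret complete_system f using f h0 by unfold_locales (auto simp: IOS_def)
  obtain \<beta> \<gamma> where \<beta>: "classKL \<beta>" and \<gamma>: "classK \<gamma>" and bd:
    "\<And>xi u (t::real) M. u \<in> inputs M \<Longrightarrow> 0 \<le> t \<Longrightarrow> norm (h0 (flow u xi t)) \<le> \<beta> (norm xi) t + \<gamma> M"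
    using IOS_flowE[OF h0] by blast
  obtain k where k: "classK k" "\<And>s. 0 \<le> s \<Longrightarrow> k (chi s) = s"
    using classKinf_inverse[OF chi] by blast
  have k2: "classK (\<lambda>s. k (2 * s))" by (intro classK_compose[OF k(1)] classK_scale) simp
  show ?thesis
  proof (rule IOS_flowI)
    show "classKL (\<lambda>s t. k (2 * \<beta> s t))" by (rule classKL_compose[OF k2 \<beta>])
    show "classK (\<lambda>s. k (2 * \<gamma> s))" by (rule classK_compose[OF k2 \<gamma>])
    fix xi u and t M :: real assume u: "(u :: real \<Rightarrow> 'm) \<in> inputs M" and t: "0 \<le> t"
    let ?x = "flow u xi t"
    have b: "0 \<le> \<beta> (norm xi) t" using classKL_nonneg[OF \<beta> _ t] by simp
    have g: "0 \<le> \<gamma> M" using classK_nonneg[OF \<gamma> inputs_nonneg[OF u]] .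
    have "norm (h ?x) = k (chi (norm (h ?x)))" using k(2) by simp
    also have "\<dots> \<le> k (\<beta> (norm xi) t + \<gamma> M)"
      using le[of ?x] bd[OF u t, of xi] chi
      by (intro classK_mono[OF k(1)] classK_nonneg[of chi]) (auto simp: classKinf_def)
    also have "\<dots> \<le> max (k (2 * \<beta> (norm xi) t)) (k (2 * \<gamma> M))"
      by (rule classK_subadd[OF k(1) b g])
    also have "\<dots> \<le> k (2 * \<beta> (norm xi) t) + k (2 * \<gamma> M)"
      using classK_nonneg[OF k2 b] classK_nonneg[OF k2 g] by simp
    finally show "norm (h ?x) \<le> k (2 * \<beta> (norm xi) t) + k (2 * \<gamma> M)" .
  qed
qed

section \<open>The redefined output\<close>

text \<open>The rescaling is \<open>\<rho> r = (\<Sum>k. a k * max (r - (1/2)^k) 0)\<close>, where the weight \<open>a k\<close> compensates the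
  Lipschitz constant of the truncation at level \<open>(1/2)^k\<close> on the ball of radius \<open>k\<close>: on a fixed ball
  this controls all but finitely many summands.\<close>
lemma lipschitz_rescaling:
  fixes V :: "'a::real_normed_vector \<Rightarrow> real"
  assumes V: "\<And>x. 0 \<le> V x"
    and trunc: "\<And>r c. 0 < c \<Longrightarrow> \<exists>C\<ge>0. \<forall>x\<in>cball 0 r. \<forall>y\<in>cball 0 r.
      \<bar>max (V x - c) 0 - max (V y - c) 0\<bar> \<le> C * norm (x - y)"
  obtains \<rho> where "classKinf \<rho>" "\<And>r. 0 \<le> r \<Longrightarrow> \<rho> r \<le> 2 * r" "loc_lipschitz (\<lambda>x. \<rho> (V x))"
proof -
  define c :: "nat \<Rightarrow> real" where "c k = (1/2) ^ k" for k
  have c_pos: "0 < c k" for k by (simp add: c_def)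
  have c_sums: "c sums 2" unfolding c_def using geometric_sums[of "1/2::real"] by simp
  have "\<exists>C. 0 \<le> C \<and> (\<forall>x\<in>cball 0 (real j). \<forall>y\<in>cball 0 (real j).
      \<bar>max (V x - c k) 0 - max (V y - c k) 0\<bar> \<le> C * norm (x - y))" for j k :: nat
    using trunc[OF c_pos] by blast
  then obtain C where C0: "\<And>j k. 0 \<le> C j k"
    and C: "\<And>j k x y. x \<in> cball 0 (real j) \<Longrightarrow> y \<in> cball 0 (real j) \<Longrightarrow>
      \<bar>max (V x - c k) 0 - max (V y - c k) 0\<bar> \<le> C j k * norm (x - y)"
    by metis
  \<comment> \<open>The weight is chosen so that both \<open>a k\<close> and
    \<open>a k * C k k\<close> are at most the summable \<open>c k\<close>.\<close>
  define a where "a k = c k / (1 + C k k)" for k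
  have a_pos: "0 < a k" for k using c_pos C0[of k k] by (simp add: a_def add_pos_nonneg)
  have aC: "a k * (1 + C k k) = c k" for k using C0[of k k] by (simp add: a_def)
  have a_le: "a k \<le> c k" for k
    using aC[of k] mult_nonneg_nonneg[OF less_imp_le[OF a_pos] C0, of k k k] by (simp add: distrib_left)
  have aC_le: "a k * C k k \<le> c k" for k using aC[of k] a_pos[of k] by (simp add: algebra_simps)
  define \<phi> where "\<phi> r k = a k * max (r - c k) 0" for r k
  have \<phi>_diff: "\<bar>\<phi> r k - \<phi> s k\<bar> \<le> c k * \<bar>r - s\<bar>" for r s k
  proof -
    have "\<bar>\<phi> r k - \<phi> s k\<bar> = a k * \<bar>max (r - c k) 0 - max (s - c k) 0\<bar>"
      using a_pos[of k] by (simp add: \<phi>_def abs_mult flip: right_diff_distrib)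
    also have "\<dots> \<le> c k * \<bar>r - s\<bar>" using a_le[of k] a_pos[of k] by (intro mult_mono) auto
    finally show ?thesis .
  qed
  have \<phi>0: "\<phi> 0 k = 0" for k using c_pos[of k] by (simp add: \<phi>_def)
  have summ: "summable (\<phi> r)" for r
  proof (rule summable_comparison_test')
    show "summable (\<lambda>k. c k * \<bar>r\<bar>)" using c_sums by (intro summable_mult2) (rule sums_summable)
    show "norm (\<phi> r k) \<le> c k * \<bar>r\<bar>" if "0 \<le> k" for k using \<phi>_diff[of r k 0] \<phi>0 by simp
  qed
  define \<rho> where "\<rho> r = (\<Sum>k. \<phi> r k)" for r
  have diff: "\<rho> r - \<rho> s = (\<Sum>k. \<phi> r k - \<phi> s k)" for r s
    unfolding \<rho>_def by (rule suminf_diff[OF summ summ])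
  \<comment> \<open>Termwise comparison is used twice: with \<open>c\<close> it shows that
    \<open>\<rho>\<close> is 2-Lipschitz, and with the sequence \<open>b\<close> below it bounds
    \<open>\<rho>\<close> composed with \<open>V\<close> on a ball.\<close>
  have diff_le: "\<bar>\<rho> r - \<rho> s\<bar> \<le> K * d"
    if le: "\<And>k. \<bar>\<phi> r k - \<phi> s k\<bar> \<le> b k * d" and b: "b sums K" for r s d b K
  proof -
    have "summable (\<lambda>k. b k * d)" using b by (intro summable_mult2) (rule sums_summable)
    then have "norm (\<Sum>k. \<phi> r k - \<phi> s k) \<le> (\<Sum>k. b k * d)"
      by (rule norm_suminf_le[rotated]) (simp add: le)
    also have "\<dots> = K * d" using sums_unique[OF sums_mult2[OF b]] by simp
    finally show ?thesis by (simp add: diff)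
  qed
  have lip: "\<bar>\<rho> r - \<rho> s\<bar> \<le> 2 * \<bar>r - s\<bar>" for r s by (rule diff_le[OF \<phi>_diff c_sums])
  have \<rho>0: "\<rho> 0 = 0" by (simp add: \<rho>_def \<phi>0)
  have \<rho>_le: "\<rho> r \<le> 2 * r" if "0 \<le> r" for r using lip[of r 0] \<rho>0 that by simp
  have "continuous_on {0..} \<rho>"
    by (rule lipschitz_on_continuous_on[of 2]) (auto intro!: lipschitz_onI simp: dist_real_def lip)
  moreover have "strict_mono_on {0..} \<rho>"
  proof (rule strict_mono_onI)
    fix r s :: real assume rs: "r \<in> {0..}" "s \<in> {0..}" "r < s"
    obtain n where n: "c n < s" using real_arch_pow_inv[of s "1/2"] rs by (auto simp: c_def)
    have mono: "0 \<le> \<phi> s k - \<phi> r k" for k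
      using a_pos[of k] rs by (auto simp: \<phi>_def intro!: mult_left_mono)
    have "0 < \<phi> s n - \<phi> r n"
      using a_pos[of n] rs n by (auto simp: \<phi>_def max_def intro!: mult_strict_left_mono)
    then have "0 < (\<Sum>k. \<phi> s k - \<phi> r k)"
      by (intro suminf_pos2[of _ n] summable_diff summ mono)
    then show "\<rho> r < \<rho> s" using diff[of s r] by simp
  qed
  moreover have "\<exists>s\<ge>0. \<rho> s > r" for r
  proof -
    \<comment> \<open>Chosen so that the summand of index 0, whose truncation level is 1, already
      equals \<open>a 0 + \<bar>r\<bar>\<close>.\<close>
    define s where "s = 2 + \<bar>r\<bar> / a 0"
    have s: "s \<ge> 1" using a_pos[of 0] by (simp add: s_def add_increasing2)
    have "a 0 * (s - 1) = a 0 + \<bar>r\<bar>" using a_pos[of 0] by (simp add: s_def field_simps)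
    then have "r < a 0 * (s - 1)" using a_pos[of 0] by linarith
    also have "\<dots> = \<phi> s 0" using s by (simp add: \<phi>_def c_def)
    also have "\<dots> \<le> \<rho> s"
      unfolding \<rho>_def using sum_le_suminf[OF summ, of "{0}" s] a_pos by (simp add: \<phi>_def less_imp_le)
    finally show ?thesis using s by (intro exI[of _ s]) simp
  qed
  ultimately have "classKinf \<rho>" using \<rho>0 by (simp add: classKinf_def classK_def)
  moreover have "loc_lipschitz (\<lambda>x. \<rho> (V x))"
    unfolding loc_lipschitz_def
  proof
    fix z :: 'a
    obtain j :: nat where j: "norm z + 1 \<le> real j" using real_arch_simple by blast
    have ball: "x \<in> cball 0 (real j)" if "x \<in> ball z 1" for x
      using that j norm_triangle_sub[of x z] by (simp add: dist_norm norm_minus_commute)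
    \<comment> \<open>For \<open>k \<ge> j\<close> the ball of radius \<open>j\<close> lies in that
      of radius \<open>k\<close>, so the weight \<open>a k\<close> absorbs the constant. The
      finitely many earlier terms keep their constants for radius \<open>j\<close>.\<close>
    define b where "b k = (if k < j then a k * C j k else c k)" for k
    have "summable b"
    proof (rule summable_comparison_test_ev)
      show "\<forall>\<^sub>F k in sequentially. norm (b k) \<le> c k"
        by (rule eventually_sequentiallyI[of j]) (use c_pos in \<open>auto simp: b_def less_imp_le\<close>)
    qed (use c_sums in \<open>rule sums_summable\<close>)
    then obtain K where K: "b sums K" by blast
    have b0: "0 \<le> b k" for k using a_pos c_pos C0 by (auto simp: b_def less_imp_le)
    have K0: "0 \<le> K" using sums_le[OF b0 sums_zero K] .
    have "\<bar>\<rho> (V x) - \<rho> (V y)\<bar> \<le> K * norm (x - y)" if xy: "x \<in> ball z 1" "y \<in> ball z 1" for x y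
    proof (rule diff_le[OF _ K])
      fix k
      let ?d = "\<bar>max (V x - c k) 0 - max (V y - c k) 0\<bar>"
      have "\<bar>\<phi> (V x) k - \<phi> (V y) k\<bar> = a k * ?d"
        using a_pos[of k] by (simp add: \<phi>_def abs_mult flip: right_diff_distrib)
      also have "\<dots> \<le> b k * norm (x - y)"
      proof (cases "k < j")
        case True
        have "a k * ?d \<le> a k * (C j k * norm (x - y))"
          using C ball xy a_pos[of k] by (intro mult_left_mono) auto
        then show ?thesis using True by (simp add: b_def)
      next
        case False
        have "a k * ?d \<le> a k * (C k k * norm (x - y))"
          using False ball[OF xy(1)] ball[OF xy(2)] a_pos[of k] by (intro mult_left_mono C) auto
        also have "\<dots> \<le> c k * norm (x - y)"
          using mult_right_mono[OF aC_le[of k], of "norm (x - y)"] by simp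
        finally show ?thesis using False by (simp add: b_def)
      qed
      finally show "\<bar>\<phi> (V x) k - \<phi> (V y) k\<bar> \<le> b k * norm (x - y)" .
    qed
    then have "K-lipschitz_on (ball z 1) (\<lambda>x. \<rho> (V x))"
      using K0 by (intro lipschitz_onI) (auto simp: dist_norm)
    then show "\<exists>e>0. \<exists>L. L-lipschitz_on (ball z e) (\<lambda>x. \<rho> (V x))"
      by (intro exI[of _ 1]) auto
  qed
  ultimately show thesis using that \<rho>_le by blast
qed

section \<open>The worst-case excess as a value function\<close>

locale ios_system = complete_system f
  for f :: "'n::euclidean_space \<times> 'm::euclidean_space \<Rightarrow> 'n" +
  fixes h :: "'n \<Rightarrow> 'y::real_normed_vector" and \<beta> \<gamma>
  assumes h_lip: "loc_lipschitz h" and \<beta>: "classKL \<beta>" and \<gamma>: "classK \<gamma>"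
    and output_le: "\<And>xi u (t::real) M. u \<in> inputs M \<Longrightarrow> 0 \<le> t \<Longrightarrow>
      norm (h (flow u xi t)) \<le> \<beta> (norm xi) t + \<gamma> M"
begin

text \<open>The extra summand \<open>M\<close> in the penalty keeps the inputs that are relevant for the supremum bounded.\<close>
definition excess :: "(real \<Rightarrow> 'm) \<Rightarrow> real \<Rightarrow> 'n \<Rightarrow> real \<Rightarrow> real" where
  "excess u M xi t = norm (h (flow u xi t)) - (\<gamma> M + M)"

definition V :: "'n \<Rightarrow> real" where
  "V xi = Sup {excess u M xi t | u t M. u \<in> inputs M \<and> 0 \<le> t}"

lemma excess_le:
  assumes "u \<in> inputs M" "0 \<le> t"
  shows "excess u M xi t \<le> \<beta> (norm xi) t - M"
  using output_le[OF assms, of xi] by (simp add: excess_def)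

lemma excess_le_V:
  assumes "u \<in> inputs M" "0 \<le> t"
  shows "excess u M xi t \<le> V xi"
  unfolding V_def
proof (rule cSup_upper)
  show "bdd_above {excess u M xi t | u t M. u \<in> inputs M \<and> 0 \<le> t}"
  proof (rule bdd_aboveI[of _ "\<beta> (norm xi) 0"], safe)
    fix u and t M :: real assume u: "(u :: real \<Rightarrow> 'm) \<in> inputs M" "0 \<le> t"
    show "excess u M xi t \<le> \<beta> (norm xi) 0"
      using excess_le[OF u, of xi] inputs_nonneg[OF u(1)]
        classKL_antimono[OF \<beta> norm_ge_zero[of xi] order_refl u(2)]
      by linarith
  qed
qed (use assms in blast)

lemma V_leI:
  assumes "\<And>u M (t::real). u \<in> inputs M \<Longrightarrow> 0 \<le> t \<Longrightarrow> excess u M xi t \<le> b"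
  shows "V xi \<le> b"
  unfolding V_def
proof (rule cSup_least)
  show "{excess u M xi t | u t M. u \<in> inputs M \<and> 0 \<le> t} \<noteq> {}"
    using zero_input[OF order_refl] order_refl by blast
qed (use assms in blast)

text \<open>The zero input with bound 0 at time 0 is one of the competitors in the supremum.\<close>

lemma norm_h_le_V: "norm (h xi) \<le> V xi"
  using excess_le_V[OF zero_input[OF order_refl] order_refl, of xi]
  by (simp add: excess_def flow_0[OF zero_input[OF order_refl]] classK_0[OF \<gamma>])

lemma V_nonneg: "0 \<le> V xi"
  using norm_h_le_V[of xi] norm_ge_zero[of "h xi"] by linarith

lemma V_0: "V 0 = 0"
proof -
  have "V 0 \<le> 0"
  proof (rule V_leI)
    fix u and M t :: real assume u: "(u :: real \<Rightarrow> 'm) \<in> inputs M" "0 \<le> t"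
    then show "excess u M 0 t \<le> 0"
      using excess_le[OF u, of 0] inputs_nonneg[OF u(1)] classK_0[OF classKL_classK[OF \<beta> u(2)]] by simp
  qed
  then show ?thesis using V_nonneg[of 0] by simp
qed

text \<open>Running \<open>u\<close> up to time \<open>t\<close> and then \<open>v\<close> is one
  trajectory whose input is bounded by \<open>max M M'\<close>, and the penalty of the maximum is at
  most the sum of the penalties.\<close>

lemma excess_flow_le:
  assumes u: "u \<in> inputs M" and t: "0 \<le> t" and v: "v \<in> inputs M'" and s: "0 \<le> s"
  shows "excess v M' (flow u xi t) s \<le> excess (splice t u v) (max M M') xi (s + t) + (\<gamma> M + M)"
proof -
  have "0 \<le> \<gamma> M" "0 \<le> \<gamma> M'"
    using classK_nonneg[OF \<gamma>] inputs_nonneg[OF u] inputs_nonneg[OF v] by auto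
  then have "\<gamma> (max M M') + max M M' \<le> (\<gamma> M + M) + (\<gamma> M' + M')"
    using inputs_nonneg[OF u] inputs_nonneg[OF v] by (auto simp: max_def)
  then show ?thesis
    unfolding excess_def flow_splice[OF u v t s] by linarith
qed

lemma splice_max_input: "u \<in> inputs M \<Longrightarrow> v \<in> inputs M' \<Longrightarrow> splice t u v \<in> inputs (max M M')"
  by (rule inputs_splice; rule inputs_mono) auto

lemma V_flow_le:
  assumes u: "u \<in> inputs M" and t: "0 \<le> t"
  shows "V (flow u xi t) \<le> V xi + (\<gamma> M + M)"
proof (rule V_leI)
  fix v and M' s :: real assume v: "(v :: real \<Rightarrow> 'm) \<in> inputs M'" and s: "0 \<le> s"
  have "excess (splice t u v) (max M M') xi (s + t) \<le> V xi"
    using s t by (intro excess_le_V splice_max_input[OF u v]) simp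
  then show "excess v M' (flow u xi t) s \<le> V xi + (\<gamma> M + M)"
    using excess_flow_le[OF u t v s, of xi] by linarith
qed

text \<open>After concatenation, every competitor from the later state has run for at least time
  \<open>t\<close> from \<open>xi\<close>, and \<open>\<beta>\<close> decreases in time.\<close>

lemma V_flow_decay:
  assumes u: "u \<in> inputs M" and t: "0 \<le> t"
  shows "V (flow u xi t) \<le> \<beta> (norm xi) t + (\<gamma> M + M)"
proof (rule V_leI)
  fix v and M' s :: real assume v: "(v :: real \<Rightarrow> 'm) \<in> inputs M'" and s: "0 \<le> s"
  have "excess (splice t u v) (max M M') xi (s + t) \<le> \<beta> (norm xi) (s + t) - max M M'"
    using s t by (intro excess_le splice_max_input[OF u v]) simp
  moreover have "\<beta> (norm xi) (s + t) \<le> \<beta> (norm xi) t"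
    using s t by (intro classKL_antimono[OF \<beta>]) auto
  ultimately show "excess v M' (flow u xi t) s \<le> \<beta> (norm xi) t + (\<gamma> M + M)"
    using excess_flow_le[OF u t v s, of xi] inputs_nonneg[OF u] by linarith
qed

text \<open>An excess above \<open>c\<close> forces \<open>c < \<beta> r t - M\<close>, which bounds
  the time by \<open>T0\<close> and the input by \<open>R\<close>. The relevant trajectories thus
  stay in one ball, where the Lipschitz constants of \<open>f\<close> and \<open>h\<close> and
  Gronwall's inequality give \<open>C\<close>.\<close>

lemma V_lipschitz_above:
  assumes c: "0 < c"
  shows "\<exists>C\<ge>0. \<forall>x\<in>cball 0 r. \<forall>y\<in>cball 0 r.
    \<bar>max (V x - c) 0 - max (V y - c) 0\<bar> \<le> C * norm (x - y)"
proof (cases "0 \<le> r")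
  case r: True
  define R where "R = \<beta> r 0"
  have "((\<lambda>t. \<beta> r t) \<longlongrightarrow> 0) at_top" using \<beta> r by (simp add: classKL_def)
  then have "\<forall>\<^sub>F t in at_top. \<beta> r t < c" using c by (rule order_tendstoD)
  then obtain T0 where T0: "\<And>t. t \<ge> T0 \<Longrightarrow> \<beta> r t < c" unfolding eventually_at_top_linorder by blast
  obtain B where B: "\<And>xi u t. xi \<in> cball 0 r \<Longrightarrow> u \<in> inputs R \<Longrightarrow> t \<in> {0..T0} \<Longrightarrow> norm (flow u xi t) \<le> B"
    using reachable_set_bounded[OF compact_cball] by metis
  obtain L where L: "L-lipschitz_on (cball 0 B \<times> cball 0 R) f"
    using loc_lipschitz_compact[OF lip compact_Times[OF compact_cball compact_cball]] .
  obtain Lh where Lh: "Lh-lipschitz_on (cball 0 B) h"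
    using loc_lipschitz_compact[OF h_lip compact_cball] .
  have L0: "0 \<le> L" and Lh0: "0 \<le> Lh" using lipschitz_on_nonneg L Lh by blast+
  define C where "C = Lh * exp (L * T0)"
  have C0: "0 \<le> C" using Lh0 by (simp add: C_def)
  \<comment> \<open>Competitors with excess at most \<open>c\<close> are absorbed by the truncation,
    so only the others need an estimate; exchanging \<open>x\<close> and \<open>y\<close> later
    gives the absolute value.\<close>
  have one: "max (V x - c) 0 \<le> max (V y - c) 0 + C * norm (x - y)"
    if x: "x \<in> cball 0 r" and y: "y \<in> cball 0 r" for x y
  proof -
    have "V x \<le> max (V y) c + C * norm (x - y)"
    proof (rule V_leI)
      fix u and M t :: real assume u: "(u :: real \<Rightarrow> 'm) \<in> inputs M" and t: "0 \<le> t"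
      have Cxy: "0 \<le> C * norm (x - y)" using C0 by simp
      show "excess u M x t \<le> max (V y) c + C * norm (x - y)"
      proof (cases "excess u M x t \<le> c")
        case True
        then show ?thesis using Cxy by linarith
      next
        case False
        have \<beta>x: "\<beta> (norm x) t \<le> \<beta> r t"
          using classK_mono[OF classKL_classK[OF \<beta> t], of "norm x" r] x by simp
        have big: "c < \<beta> r t - M" using False excess_le[OF u t, of x] \<beta>x by linarith
        have "t < T0" using big T0[of t] inputs_nonneg[OF u] by force
        then have tT: "t \<in> {0..T0}" using t by simp
        have "\<beta> r t \<le> R" unfolding R_def by (rule classKL_antimono[OF \<beta> r order_refl t])
        then have uR: "u \<in> inputs R" using big c by (intro inputs_mono[OF u]) linarith
        have in_B: "flow u z s \<in> cball 0 B" if "z \<in> cball 0 r" "s \<in> {0..T0}" for z s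
          using B[OF that(1) uR that(2)] by simp
        have "norm (flow u x t - flow u y t) \<le> norm (x - y) * exp (L * t)"
          using in_B[OF x] in_B[OF y] inputsD(2)[OF uR]
          by (intro solution_dependence[OF flow_solution_on[OF u] flow_solution_on[OF u] L0 _ tT]
              lipschitz_on_fst_arg[OF L]) auto
        also have "\<dots> \<le> norm (x - y) * exp (L * T0)"
          using tT L0 by (intro mult_left_mono) (auto intro: mult_left_mono)
        finally have "Lh * norm (flow u x t - flow u y t) \<le> Lh * (norm (x - y) * exp (L * T0))"
          using Lh0 by (rule mult_left_mono)
        moreover have "norm (h (flow u x t) - h (flow u y t)) \<le> Lh * norm (flow u x t - flow u y t)"
          using lipschitz_onD[OF Lh in_B[OF x tT] in_B[OF y tT]] by (simp add: dist_norm)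
        ultimately have "norm (h (flow u x t) - h (flow u y t)) \<le> C * norm (x - y)"
          by (simp add: C_def mult_ac)
        then have "excess u M x t \<le> excess u M y t + C * norm (x - y)"
          unfolding excess_def using norm_triangle_sub[of "h (flow u x t)" "h (flow u y t)"] by linarith
        then show ?thesis using excess_le_V[OF u t, of y] by linarith
      qed
    qed
    then show ?thesis using C0 mult_nonneg_nonneg[OF C0 norm_ge_zero[of "x - y"]] by linarith
  qed
  have "\<bar>max (V x - c) 0 - max (V y - c) 0\<bar> \<le> C * norm (x - y)"
    if "x \<in> cball 0 r" "y \<in> cball 0 r" for x y
    using one[OF that] one[OF that(2) that(1)] unfolding norm_minus_commute[of y] by linarith
  then show ?thesis using C0 by blast
qed (auto intro: exI[of _ 0])

text \<open>The rescaling \<open>\<rho>\<close> itself serves as \<open>chi\<close>. Its linear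
  bound carries the decay of \<open>V\<close> over to the new output, and its inverse
  \<open>k\<close> expresses the bound on \<open>V\<close> along trajectories through the initial
  value of that output.\<close>

theorem exists_OLIOS_output:
  obtains h0 chi where "loc_lipschitz h0" "\<And>xi. 0 \<le> h0 xi" "h0 0 = (0::real)" "classKinf chi"
    "\<And>xi. chi (norm (h xi)) \<le> h0 xi" "OLIOS f h0"
proof -
  obtain \<rho> where \<rho>: "classKinf \<rho>" and \<rho>_le: "\<And>r. 0 \<le> r \<Longrightarrow> \<rho> r \<le> 2 * r"
    and \<rho>_lip: "loc_lipschitz (\<lambda>x. \<rho> (V x))"
    using lipschitz_rescaling[of V, OF V_nonneg V_lipschitz_above] by blast
  have K: "classK \<rho>" using \<rho> by (simp add: classKinf_def)
  obtain k where k: "classK k" "\<And>s. 0 \<le> s \<Longrightarrow> k (\<rho> s) = s" using classKinf_inverse[OF \<rho>] by blast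
  let ?h0 = "\<lambda>x. \<rho> (V x)" and ?g = "\<lambda>M. \<gamma> M + M"
  have h0_nonneg: "0 \<le> ?h0 x" for x by (rule classK_nonneg[OF K V_nonneg])
  have g: "classK ?g" using classK_add[OF \<gamma> classK_scale[of 1]] by simp
  have two: "classK (\<lambda>s. 2 * s)" by (rule classK_scale) simp
  have \<rho>2: "classK (\<lambda>s. \<rho> (2 * s))" by (rule classK_compose[OF K two])
  have ios: "IOS f ?h0"
  proof (rule IOS_flowI)
    show "classKL (\<lambda>s t. 2 * \<beta> s t)" by (rule classKL_compose[OF two \<beta>])
    show "classK (\<lambda>M. 2 * ?g M)" by (rule classK_compose[OF two g])
    fix xi u and t M :: real assume u: "(u :: real \<Rightarrow> 'm) \<in> inputs M" "0 \<le> t"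
    have "?h0 (flow u xi t) \<le> 2 * V (flow u xi t)" by (rule \<rho>_le[OF V_nonneg])
    also have "\<dots> \<le> 2 * \<beta> (norm xi) t + 2 * ?g M" using V_flow_decay[OF u, of xi] by simp
    finally show "norm (?h0 (flow u xi t)) \<le> 2 * \<beta> (norm xi) t + 2 * ?g M"
      using h0_nonneg by simp
  qed
  have "OLIOS f ?h0"
  proof (rule OLIOS_flowI[OF ios])
    show "classK (\<lambda>s. \<rho> (2 * k s))" by (rule classK_compose[OF \<rho>2 k(1)])
    show "classK (\<lambda>M. \<rho> (2 * ?g M))" by (rule classK_compose[OF \<rho>2 g])
    fix xi u and t M :: real assume u: "(u :: real \<Rightarrow> 'm) \<in> inputs M" "0 \<le> t"
    have "?h0 (flow u xi t) \<le> \<rho> (V xi + ?g M)" by (rule classK_mono[OF K V_nonneg V_flow_le[OF u]])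
    also have "\<dots> \<le> max (\<rho> (2 * V xi)) (\<rho> (2 * ?g M))"
      by (rule classK_subadd[OF K V_nonneg classK_nonneg[OF g inputs_nonneg[OF u(1)]]])
    finally show "norm (?h0 (flow u xi t)) \<le> max (\<rho> (2 * k (norm (?h0 xi)))) (\<rho> (2 * ?g M))"
      using h0_nonneg k(2)[OF V_nonneg] by simp
  qed
  moreover have "\<rho> (norm (h xi)) \<le> ?h0 xi" for xi by (rule classK_mono[OF K norm_ge_zero norm_h_le_V])
  moreover have "?h0 0 = 0" by (simp add: V_0 classK_0[OF K])
  ultimately show thesis using that[of ?h0 \<rho>] \<rho>_lip h0_nonneg \<rho> by blast
qed

end

section \<open>The equivalence of both stability notions\<close>

theorem theorem2p1:
  fixes f :: "(real^'n) \<times> (real^'m) \<Rightarrow> real^'n" and h :: "real^'n \<Rightarrow> real^'p"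
  assumes "loc_lipschitz f" and "loc_lipschitz h"
    and "f (0, 0) = 0" and "h 0 = 0"
  shows "IOS f h \<longleftrightarrow>
    (\<exists>(h0 :: real^'n \<Rightarrow> real) chi. loc_lipschitz h0 \<and> (\<forall>xi. h0 xi \<ge> 0) \<and> h0 0 = 0 \<and>
       classKinf chi \<and> (\<forall>xi. h0 xi \<ge> chi (norm (h xi))) \<and> OLIOS f h0)"
proof
  assume ios: "IOS f h"
  interpret complete_system f
    using assms(1) ios by unfold_locales (auto simp: IOS_def)
  obtain \<beta> \<gamma> where "classKL \<beta>" "classK \<gamma>"
    "\<And>xi u (t::real) M. u \<in> inputs M \<Longrightarrow> 0 \<le> t \<Longrightarrow> norm (h (flow u xi t)) \<le> \<beta> (norm xi) t + \<gamma> M"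
    using IOS_flowE[OF ios] by blast
  then interpret ios_system f h \<beta> \<gamma>
    using assms(2) by unfold_locales
  show "\<exists>(h0 :: real^'n \<Rightarrow> real) chi. loc_lipschitz h0 \<and> (\<forall>xi. h0 xi \<ge> 0) \<and> h0 0 = 0 \<and>
       classKinf chi \<and> (\<forall>xi. h0 xi \<ge> chi (norm (h xi))) \<and> OLIOS f h0"
    using exists_OLIOS_output by metis
next
  assume "\<exists>(h0 :: real^'n \<Rightarrow> real) chi. loc_lipschitz h0 \<and> (\<forall>xi. h0 xi \<ge> 0) \<and> h0 0 = 0 \<and>
       classKinf chi \<and> (\<forall>xi. h0 xi \<ge> chi (norm (h xi))) \<and> OLIOS f h0"
  then show "IOS f h"
    using IOS_if_output_dominated[OF assms(1)] unfolding OLIOS_def by blast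
qed

end
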